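(* Let $\omega$ be a function of modulus of continuity type on $[0,2\pi]$ and let $H:(0,\pi]\to[0,\infty)$ be a function such that $$\int_{u}^{\pi}t^{-2}\omega(t)\,dt=O(H(u))\quad\text{and}\quad\int_{0}^{u}H(t)\,dt=O(uH(u))\qquad\text{for }u\in(0,\pi].$$ Let $f\in X_{\omega}$ and let $r$ be a positive integer. (i) If, in addition, $\omega$ satisfies $$\int_{0}^{u}t^{-1}\omega(t)\,dt=O(\omega(u))\qquad\text{for }u\in[0,2\pi],$$ then, for $n=0,1,2,\dots$, $$\left\|\widetilde{T}_{n,A}f(\cdot)-\widetilde{f}(\cdot)\right\|_{X}=O\left(\omega\left(\frac{\pi}{n+1}\right)+H\left(\frac{\pi}{n+1}\right)A_{n,r}\right).$$ (ii) If, instead, the matrix $A$ is such that $$\sum_{k=0}^{\infty}(k+1)a_{n,k}=O(n+1),$$ then, for $n=0,1,2,\dots$, $$\left\|\widetilde{T}_{n,A}f(\cdot)-\widetilde{f}\left(\cdot,\frac{\pi}{r(n+1)}\right)\right\|_{X}=O\left(\omega\left(\frac{\pi}{n+1}\right)+H\left(\frac{\pi}{n+1}\right)A_{n,r}\right).$$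
   Context: $X$ denotes either $L^{p}$ ($1\le p\le\infty$), the space of $2\pi$-periodic real-valued functions that are Lebesgue integrable with $p$-th power over $Q=[-\pi,\pi]$ (essentially bounded if $p=\infty$), with norm $\|f\|_{L^p}=(\int_Q|f(t)|^p\,dt)^{1/p}$ for $p<\infty$ and $\|f\|_{L^\infty}=\operatorname{ess\,sup}_{t\in Q}|f(t)|$; or $C$, the space of continuous $2\pi$-periodic real-valued functions with the sup norm. For $f\in X$ with real Fourier coefficients $a_\nu(f)=\frac1\pi\int_{-\pi}^{\pi}f(t)\cos\nu t\,dt$, $b_\nu(f)=\frac1\pi\int_{-\pi}^{\pi}f(t)\sin\nu t\,dt$, the partial sums of the conjugate Fourier series are $\widetilde S_kf(x)=\sum_{\nu=1}^{k}(a_\nu(f)\sin\nu x-b_\nu(f)\cos\nu x)$ (so $\widetilde S_0f=0$). Put $\psi_x(t)=f(x+t)-f(x-t)$, and for $\epsilon>0$ $$\widetilde f(x,\epsilon)=-\frac1\pi\int_\epsilon^\pi\psi_x(t)\,\frac12\cot\frac t2\,dt,\qquad \widetilde f(x)=\lim_{\epsilon\to0^+}\widetilde f(x,\epsilon),$$ the latter existing for almost all $x$. $A=(a_{n,k})_{n,k\ge0}$ is an infinite matrix of real numbers with $a_{n,k}\ge0$ for all $n,k$, $\lim_{n\to\infty}a_{n,k}=0$ for each $k$, and $\sum_{k=0}^\infty a_{n,k}=1$ for each $n$. For a positive integer $r$, $A_{n,r}=\sum_{k=0}^\infty|a_{n,k}-a_{n,k+r}|$. Further $\widetilde T_{n,A}f(x)=\sum_{k=0}^\infty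 a_{n,k}\widetilde S_kf(x)$, $n=0,1,2,\dots$. The second conjugate modulus of continuity is $\widetilde\omega_2(f,\delta)_X=\sup_{0<t\le\delta}\|\psi_\cdot(t)\|_X$ (equal to $0$ for $\delta=0$). A function of modulus of continuity type on $[0,2\pi]$ is a nondecreasing continuous function $\omega$ with $\omega(0)=0$ and $\omega(\delta_1+\delta_2)\le\omega(\delta_1)+\omega(\delta_2)$ for all $0\le\delta_1\le\delta_2\le\delta_1+\delta_2\le2\pi$. For such $\omega$, $X_\omega=\{f\in X:\widetilde\omega_2(f,\delta)_X=O(\omega(\delta))\text{ for }\delta\in[0,2\pi]\}$. All $O$-relations are uniform over the indicated range of the variable ($u$, $\delta$, or $n=0,1,2,\dots$): the implied constants do not depend on $u$, $\delta$, $n$ (they may depend on $f,\omega,H,r,A$). *)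

theory Defs
  imports
    "HOL-Analysis.Analysis"
    "HOL-Probability.Essential_Supremum"
    "HOL-Library.Landau_Symbols"
begin

text \<open>
  A relation \<open>g(u) = O(h(u))\<close> that is uniform over all \<open>u \<in> S\<close> is rendered as
  \<open>g \<in> O[principal S](h)\<close>: a property holds eventually along \<open>principal S\<close> iff it holds at every
  point of \<open>S\<close>.
\<close>

subsection \<open>The spaces\<close>

text \<open>\<open>Lp p\<close> is meant for real \<open>p \<ge> 1\<close> only. Elements of the Lebesgue spaces are represented by
  functions that are periodic at every point.\<close>

datatype fspace = Lp real | Linf | Cont

definition periodic_2pi :: "(real \<Rightarrow> real) \<Rightarrow> bool" where
  "periodic_2pi f \<longleftrightarrow> (\<forall>x. f (x + 2 * pi) = f x)"

fun space_of :: "fspace \<Rightarrow> (real \<Rightarrow> real) set" where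
  "space_of (Lp p) = {f. periodic_2pi f \<and> f \<in> borel_measurable lebesgue \<and>
      set_integrable lebesgue {-pi..pi} (\<lambda>t. \<bar>f t\<bar> powr p)}"
| "space_of Linf = {f. periodic_2pi f \<and> f \<in> borel_measurable lebesgue \<and>
      esssup (lebesgue_on {-pi..pi}) (\<lambda>t. ereal \<bar>f t\<bar>) < \<infinity>}"
| "space_of Cont = {f. periodic_2pi f \<and> continuous_on UNIV f}"

text \<open>Being real-valued, \<open>norm_of X f\<close> is meaningful only for \<open>f \<in> space_of X\<close>.\<close>

fun norm_of :: "fspace \<Rightarrow> (real \<Rightarrow> real) \<Rightarrow> real" where
  "norm_of (Lp p) f = (LINT t:{-pi..pi}|lebesgue. \<bar>f t\<bar> powr p) powr (1 / p)"
| "norm_of Linf f = real_of_ereal (esssup (lebesgue_on {-pi..pi}) (\<lambda>t. ereal \<bar>f t\<bar>))"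
| "norm_of Cont f = (SUP t. \<bar>f t\<bar>)"

text \<open>Pointwise statements hold everywhere for continuous functions and almost everywhere for
  elements of the Lebesgue spaces.\<close>

definition pointwise_in :: "fspace \<Rightarrow> (real \<Rightarrow> bool) \<Rightarrow> bool" where
  "pointwise_in X P \<longleftrightarrow> (if X = Cont then (\<forall>x. P x) else (AE x in lebesgue. P x))"

subsection \<open>Conjugate series and conjugate functions\<close>

definition fourier_a :: "(real \<Rightarrow> real) \<Rightarrow> nat \<Rightarrow> real" where
  "fourier_a f \<nu> = 1 / pi * (LINT t:{-pi..pi}|lebesgue. f t * cos (real \<nu> * t))"

definition fourier_b :: "(real \<Rightarrow> real) \<Rightarrow> nat \<Rightarrow> real" where
  "fourier_b f \<nu> = 1 / pi * (LINT t:{-pi..pi}|lebesgue. f t * sin (real \<nu> * t))"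

definition conj_partial_sum :: "(real \<Rightarrow> real) \<Rightarrow> nat \<Rightarrow> real \<Rightarrow> real" where
  "conj_partial_sum f k x =
     (\<Sum>\<nu>=1..k. fourier_a f \<nu> * sin (real \<nu> * x) - fourier_b f \<nu> * cos (real \<nu> * x))"

definition psi :: "(real \<Rightarrow> real) \<Rightarrow> real \<Rightarrow> real \<Rightarrow> real" where
  "psi f x t = f (x + t) - f (x - t)"

definition conj_trunc :: "(real \<Rightarrow> real) \<Rightarrow> real \<Rightarrow> real \<Rightarrow> real" where
  "conj_trunc f x \<epsilon> = - (1 / pi) * (LINT t:{\<epsilon>..pi}|lebesgue. psi f x t * (1 / 2 * cot (t / 2)))"

definition conj_fun :: "(real \<Rightarrow> real) \<Rightarrow> real \<Rightarrow> real" where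
  "conj_fun f x = Lim (at_right 0) (\<lambda>\<epsilon>. conj_trunc f x \<epsilon>)"

subsection \<open>Matrix means\<close>

definition summation_matrix :: "(nat \<Rightarrow> nat \<Rightarrow> real) \<Rightarrow> bool" where
  "summation_matrix a \<longleftrightarrow>
     (\<forall>n k. 0 \<le> a n k) \<and> (\<forall>k. (\<lambda>n. a n k) \<longlonglongrightarrow> 0) \<and> (\<forall>n. a n sums 1)"

definition matrix_variation :: "(nat \<Rightarrow> nat \<Rightarrow> real) \<Rightarrow> nat \<Rightarrow> nat \<Rightarrow> real" where
  "matrix_variation a n r = (\<Sum>k. \<bar>a n k - a n (k + r)\<bar>)"

definition conj_mean :: "(nat \<Rightarrow> nat \<Rightarrow> real) \<Rightarrow> nat \<Rightarrow> (real \<Rightarrow> real) \<Rightarrow> real \<Rightarrow> real" where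
  "conj_mean a n f x = (\<Sum>k. a n k * conj_partial_sum f k x)"

subsection \<open>Moduli of continuity\<close>

definition conj_modulus2 :: "fspace \<Rightarrow> (real \<Rightarrow> real) \<Rightarrow> real \<Rightarrow> real" where
  "conj_modulus2 X f \<delta> =
     (if \<delta> = 0 then 0 else (SUP t\<in>{0<..\<delta>}. norm_of X (\<lambda>x. psi f x t)))"

definition modulus_type :: "(real \<Rightarrow> real) \<Rightarrow> bool" where
  "modulus_type \<omega> \<longleftrightarrow>
     mono_on {0..2 * pi} \<omega> \<and> continuous_on {0..2 * pi} \<omega> \<and> \<omega> 0 = 0 \<and>
     (\<forall>\<delta>1 \<delta>2. 0 \<le> \<delta>1 \<and> \<delta>1 \<le> \<delta>2 \<and> \<delta>2 \<le> \<delta>1 + \<delta>2 \<and> \<delta>1 + \<delta>2 \<le> 2 * pi \<longrightarrow>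
        \<omega> (\<delta>1 + \<delta>2) \<le> \<omega> \<delta>1 + \<omega> \<delta>2)"

definition space_omega :: "fspace \<Rightarrow> (real \<Rightarrow> real) \<Rightarrow> (real \<Rightarrow> real) set" where
  "space_omega X \<omega> = {f \<in> space_of X. conj_modulus2 X f \<in> O[principal {0..2 * pi}](\<omega>)}"

end

theory Submission imports Defs begin

text \<open>
  Everything rests on one integral representation. The partial sums satisfy
  \<open>S\<^sub>k f(x) = -(1/\<pi>) \<integral>\<^sub>0\<^sup>\<pi> \<psi>\<^sub>x(t) D\<^sub>k(t) dt\<close> with the conjugate Dirichlet kernel
  \<open>D\<^sub>k(t) = sin t + ... + sin kt = (cos(t/2) - cos((k+1/2)t)) / (2 sin(t/2))\<close>. Averaging over the rows
  of the matrix and subtracting the conjugate function, in which the factor \<open>cot(t/2)/2\<close> cancels the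
  first cosine, leaves a deviation of the form \<open>\<integral>\<^sub>0\<^sup>\<pi> \<psi>\<^sub>x(t) \<kappa>(t) dt\<close> with
  \<open>\<kappa>(t) = K(t) / (2\<pi> sin(t/2))\<close> and \<open>K(t) = \<Sum>\<^sub>k a\<^sub>n\<^sub>k cos((k+1/2)t)\<close>. For the truncated conjugate
  function the kernel changes only below the truncation point, where it is
  \<open>-(1/\<pi>) \<Sum>\<^sub>k a\<^sub>n\<^sub>k D\<^sub>k(t)\<close> (\<open>conj_fun_deviation\<close>, \<open>conj_trunc_deviation\<close>).

  By Minkowski's integral inequality (\<open>psi_transform\<close>) such a function of \<open>x\<close> has norm at most
  \<open>\<integral>\<^sub>0\<^sup>\<pi> norm(\<psi>(t)) |\<kappa>(t)| dt\<close>, hence at most a constant times \<open>\<integral>\<^sub>0\<^sup>\<pi> \<omega>(t) |\<kappa>(t)| dt\<close>. This is the only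
  step in which the three kinds of spaces differ; it also yields convergence almost everywhere
  (everywhere for continuous functions). What remains is an estimate of one real integral.

  Put \<open>u = \<pi>/(n+1)\<close> and \<open>A = A\<^sub>n\<^sub>,\<^sub>r\<close>. Trivially \<open>|K| \<le> 1\<close>, and summation by parts with step \<open>r\<close> gives
  \<open>|sin(rt/2) K(t)| \<le> A\<close> (\<open>abs_sin_mult_mean_kernel_le\<close>). The difficulty for \<open>r \<ge> 2\<close> is that
  \<open>sin(rt/2)\<close> also vanishes at points \<open>2\<pi>m/r\<close> away from \<open>0\<close>. It is overcome by the fact that
  \<open>\<omega>(t)/t\<close> is decreasing up to a factor \<open>2\<close>: if \<open>d \<le> t\<close> denotes the distance from \<open>t\<close> to the nearest
  zero, then \<open>\<omega>(t)/t \<le> 2\<omega>(d)/d\<close> and \<open>|K(t)| \<le> \<pi>A/(rd)\<close>, so each zero contributes no more than the one at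
  the origin, namely \<open>A\<close> times \<open>\<integral>\<^sub>u\<^sup>\<pi> \<omega>(d)/d\<^sup>2 = O(H(u))\<close> from the points with \<open>d \<ge> u\<close>. The points \<open>t \<ge> u\<close>
  with \<open>d < u\<close> form a set of measure \<open>O(u)\<close> on which \<open>\<omega>(t)/t \<le> 2\<omega>(u)/u\<close>, and contribute \<open>O(\<omega>(u))\<close>. This
  bounds the integral over \<open>[u, \<pi>]\<close> by \<open>O(\<omega>(u) + A H(u))\<close> (\<open>tail_estimate\<close>).

  The two parts of the theorem treat \<open>(0, u)\<close> differently. In the first one, \<open>\<integral>\<^sub>0\<^sup>u \<omega>(t)/t = O(\<omega>(u))\<close> is
  assumed. In the second one, \<open>|\<Sum>\<^sub>k a\<^sub>n\<^sub>k D\<^sub>k(t)| \<le> \<Sum>\<^sub>k k a\<^sub>n\<^sub>k = O(1/u)\<close> is used below the truncation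
  point \<open>u/r\<close>, and \<open>\<omega>(t)/t \<le> r \<omega>(u)/u\<close> between \<open>u/r\<close> and \<open>u\<close>.
\<close>

section \<open>The conjugate Dirichlet kernel and its matrix means\<close>

definition conj_dirichlet :: "nat \<Rightarrow> real \<Rightarrow> real" where
  "conj_dirichlet k t = (\<Sum>\<nu>=1..k. sin (real \<nu> * t))"

text \<open>
  Multiplication by \<open>2 sin(t/2)\<close> makes the sum of sines telescope.
\<close>

lemma conj_dirichlet_closed_form:
  "2 * sin (t / 2) * conj_dirichlet k t = cos (t / 2) - cos ((real k + 1 / 2) * t)"
proof (induction k)
  case 0
  then show ?case by (simp add: conj_dirichlet_def)
next
  case (Suc k)
  have "2 * sin (t / 2) * sin (real (Suc k) * t)
      = cos ((real k + 1 / 2) * t) - cos ((real (Suc k) + 1 / 2) * t)"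
    using cos_diff_cos[of "(real k + 1 / 2) * t" "(real (Suc k) + 1 / 2) * t"]
    by (simp add: algebra_simps add_divide_distrib)
  then show ?case using Suc.IH by (simp add: conj_dirichlet_def distrib_left)
qed

lemma abs_conj_dirichlet_le: "\<bar>conj_dirichlet k t\<bar> \<le> real k"
proof -
  have "\<bar>conj_dirichlet k t\<bar> \<le> (\<Sum>\<nu>=1..k. \<bar>sin (real \<nu> * t)\<bar>)"
    unfolding conj_dirichlet_def by (rule sum_abs)
  also have "\<dots> \<le> (\<Sum>\<nu>=1..k. 1)" by (intro sum_mono) simp
  finally show ?thesis by simp
qed

text \<open>
  Jordan's inequality: the sine is concave and lies above its chord from \<open>0\<close> to \<open>\<pi>/2\<close>.
\<close>

lemma sin_ge_linear:
  assumes "0 \<le> y" "y \<le> pi / 2"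
  shows "2 * y / pi \<le> sin y"
proof -
  have "concave_on {0..pi} sin"
    unfolding concave_on_def
    by (rule f''_ge0_imp_convex[where f' = "\<lambda>x. - cos x" and f'' = sin])
       (auto intro!: derivative_eq_intros simp: sin_ge_zero)
  moreover define c where "c = 2 * y / pi"
  have "0 \<le> c" "c \<le> 1" using assms by (auto simp: c_def field_simps)
  ultimately have "(1 - c) * sin 0 + c * sin (pi / 2) \<le> sin ((1 - c) *\<^sub>R 0 + c *\<^sub>R (pi / 2))"
    by (intro concave_onD[where A = "{0..pi}"]) auto
  then show ?thesis by (simp add: c_def)
qed

lemma sin_half_ge: "0 \<le> t \<Longrightarrow> t \<le> pi \<Longrightarrow> t / pi \<le> sin (t / 2)"
  using sin_ge_linear[of "t / 2"] by simp

text \<open>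
  In contrast to the bound by \<open>k\<close>, this one is uniform in \<open>k\<close>; it is the bound that dominates all
  partial sums at once when \<open>\<psi>\<^sub>x(t)/t\<close> is integrable.
\<close>

lemma abs_conj_dirichlet_le_inverse:
  assumes "0 < t" "t \<le> pi"
  shows "\<bar>conj_dirichlet k t\<bar> \<le> pi / t"
proof -
  have s: "t / pi \<le> sin (t / 2)" using assms by (intro sin_half_ge) auto
  have "2 * sin (t / 2) * \<bar>conj_dirichlet k t\<bar> = \<bar>2 * sin (t / 2) * conj_dirichlet k t\<bar>"
    using s assms by (simp add: abs_mult order_trans[OF _ s])
  also have "\<dots> \<le> 2"
    unfolding conj_dirichlet_closed_form
    using abs_triangle_ineq4[of "cos (t / 2)" "cos ((real k + 1 / 2) * t)"]
      abs_cos_le_one[of "t / 2"] abs_cos_le_one[of "(real k + 1 / 2) * t"] by linarith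
  finally have "sin (t / 2) * \<bar>conj_dirichlet k t\<bar> \<le> 1" by simp
  moreover have "t / pi * \<bar>conj_dirichlet k t\<bar> \<le> sin (t / 2) * \<bar>conj_dirichlet k t\<bar>"
    using s by (intro mult_right_mono) auto
  ultimately have "t / pi * \<bar>conj_dirichlet k t\<bar> \<le> 1" by linarith
  then show ?thesis using assms by (simp add: field_simps)
qed

definition mean_kernel :: "(nat \<Rightarrow> real) \<Rightarrow> real \<Rightarrow> real" where
  "mean_kernel a t = (\<Sum>k. a k * cos ((real k + 1 / 2) * t))"

definition row_variation :: "(nat \<Rightarrow> real) \<Rightarrow> nat \<Rightarrow> real" where
  "row_variation a r = (\<Sum>k. \<bar>a k - a (k + r)\<bar>)"

lemma borel_measurable_mean_kernel [measurable]: "mean_kernel a \<in> borel_measurable borel"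
  unfolding mean_kernel_def by measurable

lemma summable_mult_bounded:
  fixes a b :: "nat \<Rightarrow> real"
  assumes "\<And>k. 0 \<le> a k" "summable a" "\<And>k. \<bar>b k\<bar> \<le> c"
  shows "summable (\<lambda>k. a k * b k)"
proof (rule summable_comparison_test)
  show "\<exists>N. \<forall>k\<ge>N. norm (a k * b k) \<le> c * a k"
    using assms(1,3) by (auto simp: abs_mult mult.commute[of c] intro!: mult_left_mono)
  show "summable (\<lambda>k. c * a k)" using assms(2) by (rule summable_mult)
qed

lemma abs_suminf_le:
  fixes f g :: "nat \<Rightarrow> real"
  assumes g: "summable g" and le: "\<And>k. \<bar>f k\<bar> \<le> g k"
  shows "\<bar>suminf f\<bar> \<le> suminf g"
proof -
  have s: "summable (\<lambda>k. \<bar>f k\<bar>)"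
    using g by (rule summable_comparison_test[rotated]) (use le in auto)
  have "\<bar>suminf f\<bar> \<le> (\<Sum>k. \<bar>f k\<bar>)" using s by (rule summable_rabs)
  also have "\<dots> \<le> suminf g" using le s g by (rule suminf_le)
  finally show ?thesis .
qed

context
  fixes a :: "nat \<Rightarrow> real"
  assumes a_nonneg: "\<And>k. 0 \<le> a k" and a_sums: "a sums 1"
begin

lemma row_summable: "summable a"
  using a_sums by (rule sums_summable)

lemma mean_kernel_summable: "summable (\<lambda>k. a k * cos ((real k + 1 / 2) * t))"
  by (intro summable_mult_bounded[where c = 1] a_nonneg row_summable) simp

lemma abs_mean_kernel_le_1: "\<bar>mean_kernel a t\<bar> \<le> 1"
proof -
  have "\<bar>mean_kernel a t\<bar> \<le> suminf a"
    unfolding mean_kernel_def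
    using row_summable a_nonneg by (intro abs_suminf_le) (auto simp: abs_mult intro!: mult_left_le)
  then show ?thesis using a_sums by (simp add: sums_iff)
qed

lemma row_variation_summable: "summable (\<lambda>k. \<bar>a k - a (k + r)\<bar>)"
proof (rule summable_comparison_test)
  show "\<exists>N. \<forall>k\<ge>N. norm \<bar>a k - a (k + r)\<bar> \<le> a k + a (k + r)"
  proof (intro exI[of _ 0] allI impI)
    fix k
    show "norm \<bar>a k - a (k + r)\<bar> \<le> a k + a (k + r)"
      using a_nonneg[of k] a_nonneg[of "k + r"] by simp
  qed
  show "summable (\<lambda>k. a k + a (k + r))"
    using row_summable by (intro summable_add) (auto simp: summable_ignore_initial_segment)
qed

lemma row_variation_nonneg: "0 \<le> row_variation a r"
  unfolding row_variation_def using row_variation_summable by (rule suminf_nonneg) simp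

text \<open>
  Because the entries of the row sum up to a finite value, the sum of the differences
  \<open>a\<^sub>k - a\<^sub>k\<^sub>+\<^sub>r\<close> telescopes to the sum of the first \<open>r\<close> entries.
\<close>

lemma head_le_row_variation: "(\<Sum>k<r. a k) \<le> row_variation a r"
proof -
  have s: "summable (\<lambda>k. a (k + r))" using row_summable by (simp add: summable_ignore_initial_segment)
  have "(\<Sum>k<r. a k) = (\<Sum>k. a k - a (k + r))"
    using suminf_split_initial_segment[OF row_summable, of r] suminf_diff[OF row_summable s] by simp
  also have "\<dots> \<le> row_variation a r"
    unfolding row_variation_def
    using row_variation_summable summable_diff[OF row_summable s] by (intro suminf_le) auto
  finally show ?thesis .
qed

text \<open>
  Summation by parts with step \<open>r\<close>: with \<open>s\<^sub>k = sin((k+1/2-r/2)t)\<close> one has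
  \<open>2 sin(rt/2) cos((k+1/2)t) = s\<^sub>k\<^sub>+\<^sub>r - s\<^sub>k\<close>, so that \<open>2 sin(rt/2) K(t)\<close> equals
  \<open>\<Sum>\<^sub>k (a\<^sub>k - a\<^sub>k\<^sub>+\<^sub>r) s\<^sub>k\<^sub>+\<^sub>r\<close> minus \<open>\<Sum>\<^sub>k a\<^sub>k s\<^sub>k\<close> over \<open>k < r\<close>. Each of the two parts is at most the variation.
\<close>

lemma abs_sin_mult_mean_kernel_le:
  "\<bar>sin (real r * t / 2) * mean_kernel a t\<bar> \<le> row_variation a r"
proof -
  define s where "s k = sin ((real k + 1 / 2 - real r / 2) * t)" for k
  have s_le: "\<bar>s k\<bar> \<le> 1" for k by (simp add: s_def)
  have sum1: "summable (\<lambda>k. a k * s k)"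
    by (intro summable_mult_bounded[where c = 1] a_nonneg row_summable s_le)
  have sum2: "summable (\<lambda>k. a k * s (k + r))"
    by (intro summable_mult_bounded[where c = 1] a_nonneg row_summable s_le)
  have sum3: "summable (\<lambda>k. a (k + r) * s (k + r))"
    using sum1 by (subst summable_iff_shift)
  have step: "2 * (sin (real r * t / 2) * cos ((real k + 1 / 2) * t)) = s (k + r) - s k" for k
  proof -
    have "(real (k + r) + 1 / 2 - real r / 2) * t = (real k + 1 / 2) * t + real r * t / 2"
      by (simp add: field_simps)
    moreover have "(real k + 1 / 2 - real r / 2) * t = (real k + 1 / 2) * t - real r * t / 2"
      by (simp add: field_simps)
    ultimately show ?thesis unfolding s_def by (simp only: sin_add sin_diff) simp
  qed
  have "2 * (sin (real r * t / 2) * mean_kernel a t)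
      = (\<Sum>k. 2 * (sin (real r * t / 2) * (a k * cos ((real k + 1 / 2) * t))))"
    unfolding mean_kernel_def using mean_kernel_summable by (simp add: suminf_mult summable_mult)
  also have "\<dots> = (\<Sum>k. a k * s (k + r) - a k * s k)"
    by (rule arg_cong[where f = suminf]) (auto simp: fun_eq_iff right_diff_distrib[symmetric] step[symmetric])
  also have "\<dots> = (\<Sum>k. a k * s (k + r)) - (\<Sum>k. a k * s k)"
    using sum1 sum2 by (simp add: suminf_diff)
  also have "(\<Sum>k. a k * s k) = (\<Sum>k. a (k + r) * s (k + r)) + (\<Sum>k<r. a k * s k)"
    using suminf_split_initial_segment[OF sum1, of r] by simp
  also have "(\<Sum>k. a k * s (k + r)) - ((\<Sum>k. a (k + r) * s (k + r)) + (\<Sum>k<r. a k * s k))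
     = (\<Sum>k. (a k - a (k + r)) * s (k + r)) - (\<Sum>k<r. a k * s k)"
    using suminf_diff[OF sum2 sum3] by (simp add: left_diff_distrib)
  finally have eq: "2 * (sin (real r * t / 2) * mean_kernel a t)
     = (\<Sum>k. (a k - a (k + r)) * s (k + r)) - (\<Sum>k<r. a k * s k)" .
  have "\<bar>\<Sum>k. (a k - a (k + r)) * s (k + r)\<bar> \<le> row_variation a r"
    unfolding row_variation_def
    using row_variation_summable s_le by (intro abs_suminf_le) (auto simp: abs_mult intro!: mult_left_le)
  moreover have "\<bar>\<Sum>k<r. a k * s k\<bar> \<le> row_variation a r"
  proof -
    have "\<bar>\<Sum>k<r. a k * s k\<bar> \<le> (\<Sum>k<r. \<bar>a k * s k\<bar>)" by (rule sum_abs)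
    also have "\<dots> \<le> (\<Sum>k<r. a k)"
      using s_le a_nonneg by (intro sum_mono) (auto simp: abs_mult intro!: mult_left_le)
    also have "\<dots> \<le> row_variation a r" by (rule head_le_row_variation)
    finally show ?thesis .
  qed
  ultimately have "\<bar>2 * (sin (real r * t / 2) * mean_kernel a t)\<bar> \<le> 2 * row_variation a r"
    unfolding eq by linarith
  then show ?thesis by (simp add: abs_mult)
qed

lemma sums_conj_dirichlet:
  assumes "0 < t" "t \<le> pi"
  shows "(\<lambda>k. a k * conj_dirichlet k t) sums
    (1 / 2 * cot (t / 2) - mean_kernel a t / (2 * sin (t / 2)))"
proof -
  have s: "sin (t / 2) > 0" using assms by (intro sin_gt_zero) auto
  have "(\<lambda>k. a k * cos (t / 2) - a k * cos ((real k + 1 / 2) * t)) sums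
      (1 * cos (t / 2) - mean_kernel a t)"
    unfolding mean_kernel_def
    by (intro sums_diff sums_mult2 a_sums summable_sums mean_kernel_summable)
  from sums_divide[OF this, of "2 * sin (t / 2)"]
  have "(\<lambda>k. (a k * cos (t / 2) - a k * cos ((real k + 1 / 2) * t)) / (2 * sin (t / 2))) sums
      ((cos (t / 2) - mean_kernel a t) / (2 * sin (t / 2)))" by simp
  moreover have "(a k * cos (t / 2) - a k * cos ((real k + 1 / 2) * t)) / (2 * sin (t / 2))
      = a k * conj_dirichlet k t" for k
  proof -
    have "a k * cos (t / 2) - a k * cos ((real k + 1 / 2) * t)
        = a k * (2 * sin (t / 2) * conj_dirichlet k t)"
      unfolding conj_dirichlet_closed_form by (rule right_diff_distrib[symmetric])
    then show ?thesis using s by simp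
  qed
  moreover have "(cos (t / 2) - mean_kernel a t) / (2 * sin (t / 2))
      = 1 / 2 * cot (t / 2) - mean_kernel a t / (2 * sin (t / 2))"
    using s by (simp add: cot_def diff_divide_distrib)
  ultimately show ?thesis by simp
qed

end

text \<open>
  Near a zero \<open>2\<pi>m/r\<close> the function \<open>|sin(rt/2)|\<close> is a translate of itself near \<open>0\<close>, where Jordan's
  inequality applies.
\<close>

lemma sin_multiple_ge_distance:
  fixes r m :: nat
  assumes r: "0 < r" and t: "\<bar>t - 2 * pi * real m / real r\<bar> \<le> pi / real r"
  shows "real r * \<bar>t - 2 * pi * real m / real r\<bar> / pi \<le> \<bar>sin (real r * t / 2)\<bar>"
proof -
  define d where "d = t - 2 * pi * real m / real r"
  have "real r * t / 2 = real r * d / 2 + real m * pi"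
    using r by (simp add: d_def field_simps)
  then have "\<bar>sin (real r * t / 2)\<bar> = \<bar>sin (real r * d / 2)\<bar>"
    by (simp only: sin_add) (simp add: abs_mult)
  also have "\<dots> = \<bar>sin (real r * \<bar>d\<bar> / 2)\<bar>"
    by (cases "d \<ge> 0") auto
  also have "\<dots> \<ge> 2 * (real r * \<bar>d\<bar> / 2) / pi"
  proof -
    have "\<bar>d\<bar> * real r \<le> pi" using t r unfolding d_def by (simp only: pos_le_divide_eq of_nat_0_less_iff)
    then show ?thesis
      by (intro order_trans[OF sin_ge_linear abs_ge_self]) (auto simp: mult.commute)
  qed
  finally show ?thesis by (simp add: d_def)
qed

text \<open>
  The last bound is what lets the almost decreasing function \<open>\<omega>(t)/t\<close> be compared with its value at
  the distance to the zero: for \<open>m = 0\<close> that distance is \<open>t\<close> itself, and for \<open>m \<ge> 1\<close> it is at most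
  \<open>\<pi>/r\<close>, whereas \<open>t \<ge> 2\<pi>m/r - \<pi>/r \<ge> \<pi>/r\<close>.
\<close>

lemma nearest_zero_exists:
  fixes r :: nat
  assumes r: "0 < r" and t: "0 < t" "t \<le> pi"
  obtains m where "m \<le> r" "\<bar>t - 2 * pi * real m / real r\<bar> \<le> pi / real r"
    "\<bar>t - 2 * pi * real m / real r\<bar> \<le> t"
proof
  define y where "y = real r * t / (2 * pi)"
  define m where "m = nat \<lfloor>y + 1 / 2\<rfloor>"
  have y: "0 < y" "y \<le> real r / 2" using r t by (auto simp: y_def field_simps)
  have m: "real m \<le> y + 1 / 2" "y + 1 / 2 < real m + 1"
    using y by (auto simp: m_def of_nat_nat)
  have "real m < real r + 1" using m y r by linarith
  then show "m \<le> r" by linarith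
  have t_eq: "t = 2 * pi / real r * y" using r by (simp add: y_def)
  have eq: "t - 2 * pi * real m / real r = 2 * pi / real r * (y - real m)"
    unfolding t_eq by (simp add: algebra_simps diff_divide_distrib)
  have "\<bar>y - real m\<bar> \<le> 1 / 2" using m by linarith
  then have "2 * pi / real r * \<bar>y - real m\<bar> \<le> 2 * pi / real r * (1 / 2)"
    by (intro mult_left_mono) auto
  then show "\<bar>t - 2 * pi * real m / real r\<bar> \<le> pi / real r"
    unfolding eq by (simp add: abs_mult)
  have "\<bar>y - real m\<bar> \<le> y"
  proof (cases "m = 0")
    case False
    then have "1 \<le> real m" by simp
    then show ?thesis using m by linarith
  qed (use y in simp)
  then have "2 * pi / real r * \<bar>y - real m\<bar> \<le> 2 * pi / real r * y"
    by (intro mult_left_mono) auto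
  then show "\<bar>t - 2 * pi * real m / real r\<bar> \<le> t"
    unfolding eq t_eq[symmetric] by (simp add: abs_mult)
qed

section \<open>Moduli of continuity and the tail of the kernel integral\<close>

text \<open>
  Continuing \<open>\<omega>\<close> by its values at \<open>0\<close> and \<open>2\<pi>\<close> yields a function that is continuous, hence Borel
  measurable, on the whole line, so that it can serve as an integrand without cut-off.
\<close>

definition clipped :: "(real \<Rightarrow> real) \<Rightarrow> real \<Rightarrow> real" where
  "clipped \<omega> t = \<omega> (max 0 (min t (2 * pi)))"

lemma clipped_eq: "0 \<le> t \<Longrightarrow> t \<le> 2 * pi \<Longrightarrow> clipped \<omega> t = \<omega> t"
  by (simp add: clipped_def)

context
  fixes \<omega> :: "real \<Rightarrow> real"
  assumes mod: "modulus_type \<omega>"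
begin

lemma continuous_on_clipped: "continuous_on UNIV (clipped \<omega>)"
proof -
  have "continuous_on {0..2 * pi} \<omega>" using mod by (simp add: modulus_type_def)
  then have "continuous_on UNIV (\<lambda>t. \<omega> (max 0 (min t (2 * pi))))"
    by (rule continuous_on_compose2) (auto intro!: continuous_intros)
  then show ?thesis by (simp add: clipped_def[abs_def])
qed

lemma borel_measurable_clipped: "clipped \<omega> \<in> borel_measurable borel"
  using continuous_on_clipped by (rule borel_measurable_continuous_onI)

lemma modulus_mono: "0 \<le> s \<Longrightarrow> s \<le> t \<Longrightarrow> t \<le> 2 * pi \<Longrightarrow> \<omega> s \<le> \<omega> t"
  using mod by (auto simp: modulus_type_def mono_on_def)

lemma modulus_nonneg: "0 \<le> t \<Longrightarrow> t \<le> 2 * pi \<Longrightarrow> 0 \<le> \<omega> t"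
  using modulus_mono[of 0 t] mod by (simp add: modulus_type_def)

lemma clipped_nonneg: "0 \<le> clipped \<omega> t"
  unfolding clipped_def by (rule modulus_nonneg) auto

lemma modulus_subadd: "0 \<le> s \<Longrightarrow> 0 \<le> t \<Longrightarrow> s + t \<le> 2 * pi \<Longrightarrow> \<omega> (s + t) \<le> \<omega> s + \<omega> t"
  using mod unfolding modulus_type_def by (metis add.commute le_add_same_cancel2 linorder_linear)

lemma modulus_multiple_le: "0 \<le> s \<Longrightarrow> real k * s \<le> 2 * pi \<Longrightarrow> \<omega> (real k * s) \<le> real k * \<omega> s"
proof (induction k)
  case 0
  then show ?case using mod by (simp add: modulus_type_def)
next
  case (Suc k)
  have "real k * s + s \<le> 2 * pi" using Suc.prems by (simp add: algebra_simps)
  then have "\<omega> (real k * s + s) \<le> \<omega> (real k * s) + \<omega> s"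
    using Suc.prems by (intro modulus_subadd) auto
  moreover have "\<omega> (real k * s) \<le> real k * \<omega> s"
    using Suc.prems by (intro Suc.IH) (auto simp: algebra_simps)
  ultimately show ?case by (simp add: algebra_simps)
qed

text \<open>
  Write \<open>t\<close> as \<open>k s\<close> plus a remainder below \<open>s\<close>. Subadditivity gives \<open>\<omega>(t) \<le> (k + 1) \<omega>(s)\<close>, and
  \<open>k + 1 \<le> 2k \<le> 2t/s\<close>. Splitting off the remainder, instead of rounding \<open>t/s\<close> up, keeps all arguments
  inside \<open>[0, 2\<pi>]\<close>.
\<close>

lemma modulus_almost_decreasing:
  assumes "0 < s" "s \<le> t" "t \<le> 2 * pi"
  shows "\<omega> t / t \<le> 2 * \<omega> s / s"
proof -
  define k where "k = nat \<lfloor>t / s\<rfloor>"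
  have "1 \<le> t / s" using assms by simp
  then have k1: "1 \<le> real k" and k: "real k \<le> t / s" and k': "t / s < real k + 1"
    by (auto simp: k_def le_nat_iff le_floor_iff)
  have ks: "real k * s \<le> t" "t < (real k + 1) * s"
    using k k' assms by (auto simp: field_simps)
  have "\<omega> t = \<omega> (real k * s + (t - real k * s))" by simp
  also have "\<dots> \<le> \<omega> (real k * s) + \<omega> (t - real k * s)"
    using assms ks by (intro modulus_subadd) auto
  also have "\<dots> \<le> real k * \<omega> s + \<omega> s"
    using assms ks by (intro add_mono modulus_multiple_le modulus_mono) (auto simp: algebra_simps)
  also have "\<dots> = (real k + 1) * \<omega> s" by (simp add: algebra_simps)
  also have "\<dots> \<le> (2 * (t / s)) * \<omega> s"
    using k k1 assms by (intro mult_right_mono modulus_nonneg) auto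
  finally show ?thesis using assms by (simp add: field_simps)
qed

lemma set_integrable_modulus_div_square:
  assumes "0 < u"
  shows "set_integrable lborel {u..pi} (\<lambda>s. clipped \<omega> s / s\<^sup>2)"
  using assms
  by (intro borel_integrable_atLeastAtMost' continuous_intros continuous_on_subset[OF continuous_on_clipped]) auto

text \<open>
  The integrand is dominated by a sum of translates \<open>B(t - z\<^sub>m)\<close> of one even function, one for every
  zero \<open>z\<^sub>m = 2\<pi>m/r\<close>. The constant part of \<open>B\<close> on \<open>[-u, u]\<close> covers the points close to a zero, where only
  \<open>|K| \<le> 1\<close> is available, and \<open>G\<close> covers the points at distance at least \<open>u\<close>, where the variation of
  the row enters. Since Lebesgue measure is translation invariant, all \<open>r + 1\<close> integrals are equal.
\<close>

lemma tail_estimate: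
  fixes a :: "nat \<Rightarrow> real"
  assumes a: "\<And>k. 0 \<le> a k" "a sums 1" and r: "0 < r" and u: "0 < u" "u \<le> pi"
  shows "(\<integral>\<^sup>+t\<in>{u..pi}. ennreal (\<omega> t / t * \<bar>mean_kernel a t\<bar>) \<partial>lborel)
    \<le> ennreal ((real r + 1) * (4 * \<omega> u
         + 4 * pi / real r * row_variation a r * (LINT t:{u..pi}|lebesgue. \<omega> t / t\<^sup>2)))"
proof -
  note [measurable] = borel_measurable_clipped
  define A where "A = row_variation a r"
  have A: "0 \<le> A" unfolding A_def using a by (rule row_variation_nonneg)
  define I where "I = (LINT t:{u..pi}|lebesgue. \<omega> t / t\<^sup>2)"
  have I_eq: "I = (LINT s:{u..pi}|lborel. clipped \<omega> s / s\<^sup>2)"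
  proof -
    have "I = (LINT t:{u..pi}|lebesgue. clipped \<omega> t / t\<^sup>2)"
      unfolding I_def using u by (intro set_lebesgue_integral_cong) (auto simp: clipped_eq)
    then show ?thesis
      unfolding set_lebesgue_integral_def by (subst (asm) integral_completion) auto
  qed
  have I: "0 \<le> I"
    unfolding I_eq set_lebesgue_integral_def by (intro Bochner_Integration.integral_nonneg) (auto simp: clipped_nonneg)
  have \<omega>u: "0 \<le> \<omega> u" using u by (intro modulus_nonneg) auto
  define G where "G s = ennreal (2 * pi * A / real r * (indicator {u..pi} s * (clipped \<omega> s / s\<^sup>2)))" for s
  have [measurable]: "G \<in> borel_measurable borel" unfolding G_def by measurable
  have G_int: "(\<integral>\<^sup>+s. G s \<partial>lborel) = ennreal (2 * pi * A / real r * I)"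
  proof -
    have "integrable lborel (\<lambda>s. 2 * pi * A / real r * (indicator {u..pi} s * (clipped \<omega> s / s\<^sup>2)))"
      using set_integrable_modulus_div_square[OF u(1)] unfolding set_integrable_def
      by (intro integrable_mult_right) simp
    then show ?thesis
      unfolding G_def I_eq set_lebesgue_integral_def
      using A clipped_nonneg
      by (subst nn_integral_eq_integral) (auto simp del: times_divide_eq_left times_divide_eq_right)
  qed
  define B where "B s = ennreal (2 * \<omega> u / u) * indicator {-u..u} s + (G s + G (- s))" for s
  have [measurable]: "B \<in> borel_measurable borel" unfolding B_def by measurable
  have B_int: "(\<integral>\<^sup>+s. B s \<partial>lborel) = ennreal (4 * \<omega> u + 4 * pi / real r * A * I)"
  proof -
    define c where "c = 2 * pi * A / real r * I"
    have c: "0 \<le> c" using A I by (simp add: c_def)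
    have G: "(\<integral>\<^sup>+s. G s \<partial>lborel) = ennreal c" unfolding G_int c_def ..
    have G': "(\<integral>\<^sup>+s. G (- s) \<partial>lborel) = ennreal c"
      using nn_integral_real_affine[of G "- 1" 0] G by simp
    have "ennreal (2 * \<omega> u / u) * ennreal (2 * u) = ennreal (4 * \<omega> u)"
      using u \<omega>u by (subst ennreal_mult[symmetric]) auto
    then have "(\<integral>\<^sup>+s. B s \<partial>lborel) = ennreal (4 * \<omega> u + 2 * c)"
      unfolding B_def using u \<omega>u c
      by (simp add: nn_integral_add nn_integral_cmult_indicator G G' flip: ennreal_plus)
    also have "4 * \<omega> u + 2 * c = 4 * \<omega> u + 4 * pi / real r * A * I"
      by (simp add: c_def)
    finally show ?thesis .
  qed
  \<comment> \<open>The zeros of \<open>sin(rt/2)\<close>.\<close>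
  define z where "z m = 2 * pi * real m / real r" for m :: nat
  have pointwise: "ennreal (\<omega> t / t * \<bar>mean_kernel a t\<bar>) \<le> (\<Sum>m\<le>r. B (t - z m))" if t: "u \<le> t" "t \<le> pi" for t
  proof -
    have t0: "0 < t" using t u by simp
    obtain m where m: "m \<le> r" "\<bar>t - z m\<bar> \<le> pi / real r" "\<bar>t - z m\<bar> \<le> t"
      using nearest_zero_exists[OF r t0 t(2)] unfolding z_def by blast
    define d where "d = \<bar>t - z m\<bar>"
    have K1: "\<bar>mean_kernel a t\<bar> \<le> 1" using a by (rule abs_mean_kernel_le_1)
    have \<omega>t: "0 \<le> \<omega> t / t" using t u by (intro divide_nonneg_pos modulus_nonneg) auto
    have "ennreal (\<omega> t / t * \<bar>mean_kernel a t\<bar>) \<le> B (t - z m)"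
    proof (cases "d < u")
      case True
      have "\<omega> t / t * \<bar>mean_kernel a t\<bar> \<le> \<omega> t / t"
        using K1 \<omega>t by (rule mult_left_le)
      also have "\<dots> \<le> 2 * \<omega> u / u" using t u by (intro modulus_almost_decreasing) auto
      finally have "ennreal (\<omega> t / t * \<bar>mean_kernel a t\<bar>) \<le> ennreal (2 * \<omega> u / u)" by (rule ennreal_leI)
      also have "\<dots> \<le> B (t - z m)"
        using True unfolding B_def d_def by (auto simp: indicator_def abs_less_iff)
      finally show ?thesis .
    next
      case False
      then have d: "u \<le> d" "0 < d" "d \<le> t" "d \<le> pi" using u m t by (auto simp: d_def)
      have "real r * d / pi \<le> \<bar>sin (real r * t / 2)\<bar>"
        using sin_multiple_ge_distance[OF r m(2)[unfolded z_def]] by (simp add: d_def z_def)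
      then have "real r * d / pi * \<bar>mean_kernel a t\<bar> \<le> \<bar>sin (real r * t / 2) * mean_kernel a t\<bar>"
        unfolding abs_mult by (rule mult_right_mono) simp
      also have "\<dots> \<le> A" unfolding A_def using a by (rule abs_sin_mult_mean_kernel_le)
      finally have K2: "\<bar>mean_kernel a t\<bar> \<le> A * pi / (real r * d)"
        using r d by (simp add: field_simps)
      have "\<omega> t / t * \<bar>mean_kernel a t\<bar> \<le> (2 * \<omega> d / d) * (A * pi / (real r * d))"
        using K2 d t modulus_nonneg[of d] by (intro mult_mono modulus_almost_decreasing) auto
      also have "\<dots> = 2 * pi * A / real r * (indicator {u..pi} d * (clipped \<omega> d / d\<^sup>2))"
        using d by (simp add: clipped_eq power2_eq_square field_simps)
      finally have "ennreal (\<omega> t / t * \<bar>mean_kernel a t\<bar>) \<le> G d"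
        unfolding G_def by (rule ennreal_leI)
      also have "G d \<le> G (t - z m) + G (- (t - z m))"
        unfolding d_def by (cases "t - z m \<ge> 0") auto
      also have "\<dots> \<le> B (t - z m)" unfolding B_def by auto
      finally show ?thesis .
    qed
    also have "\<dots> \<le> (\<Sum>m\<le>r. B (t - z m))"
      using m by (intro member_le_sum) auto
    finally show ?thesis .
  qed
  have "(\<integral>\<^sup>+t\<in>{u..pi}. ennreal (\<omega> t / t * \<bar>mean_kernel a t\<bar>) \<partial>lborel)
      \<le> (\<integral>\<^sup>+t. (\<Sum>m\<le>r. B (t - z m)) \<partial>lborel)"
    using pointwise by (intro nn_integral_mono) (auto split: split_indicator)
  also have "\<dots> = (\<Sum>m\<le>r. \<integral>\<^sup>+t. B (t - z m) \<partial>lborel)"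
    by (rule nn_integral_sum) auto
  also have "\<dots> = (\<Sum>m\<le>r. \<integral>\<^sup>+s. B s \<partial>lborel)"
    using nn_integral_real_affine[of B 1 "- z _"] by (intro sum.cong refl) simp
  also have "\<dots> = ennreal ((real r + 1) * (4 * \<omega> u + 4 * pi / real r * A * I))"
  proof -
    have "0 \<le> 4 * \<omega> u + 4 * pi / real r * A * I" using A I \<omega>u by simp
    then have "(\<Sum>m\<le>r. ennreal (4 * \<omega> u + 4 * pi / real r * A * I))
        = ennreal (\<Sum>m\<le>r. 4 * \<omega> u + 4 * pi / real r * A * I)"
      by (intro sum_ennreal) simp
    then show ?thesis unfolding B_int by (simp add: algebra_simps)
  qed
  finally show ?thesis unfolding A_def I_def .
qed

end

section \<open>Periodic functions and the integral form of the partial sums\<close>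

lemma interval_in_sets_lebesgue [measurable]:
  fixes a b :: real
  shows "{a..b} \<in> sets lebesgue" "{a<..b} \<in> sets lebesgue" "{a..<b} \<in> sets lebesgue"
  by auto

lemma borel_measurable_lebesgueI:
  "g \<in> borel_measurable borel \<Longrightarrow> g \<in> borel_measurable lebesgue"
  by (rule measurable_completion) simp

lemma borel_measurable_lebesgue_ident [measurable]: "(\<lambda>x::real. x) \<in> borel_measurable lebesgue"
  by (rule borel_measurable_lebesgueI) simp

lemma AE_lebesgue_affine:
  fixes P :: "real \<Rightarrow> bool"
  assumes P: "AE x in lebesgue. P x" and c: "c \<noteq> 0"
  shows "AE x in lebesgue. P (t + c * x)"
proof -
  define N where "N = {x. \<not> P x}"
  have N: "N \<in> null_sets lebesgue"
    using P by (simp add: N_def completion.AE_iff_null_sets)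
  then have [measurable]: "N \<in> sets lebesgue" by auto
  have meas: "(\<lambda>x. indicator N x :: ennreal) \<in> borel_measurable lebesgue" by measurable
  have T: "(\<lambda>x. t + c * x) \<in> lebesgue \<rightarrow>\<^sub>M lebesgue"
    using lebesgue_affine_measurable[where c = "\<lambda>x::real. c"] c by simp
  have "ennreal \<bar>c\<bar> * (\<integral>\<^sup>+x. indicator N (t + c * x) \<partial>lebesgue) = 0"
    unfolding nn_integral_real_affine_lebesgue[OF meas c, of t, symmetric]
    by (subst nn_integral_indicator) (use N in \<open>auto simp del: emeasure_completion\<close>)
  then have "(\<integral>\<^sup>+x. indicator N (t + c * x) \<partial>lebesgue) = 0" using c by simp
  moreover have "(\<lambda>x. indicator N (t + c * x) :: ennreal) \<in> borel_measurable lebesgue"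
    using measurable_compose[OF T meas] .
  ultimately have "AE x in lebesgue. (indicator N (t + c * x) :: ennreal) = 0"
    by (subst (asm) nn_integral_0_iff_AE) auto
  then show ?thesis by (auto simp: N_def indicator_def split: if_splits elim!: eventually_mono)
qed

lemma periodic_shift_int:
  assumes "\<And>x. h (x + 2 * pi) = h x"
  shows "h (x + 2 * pi * real_of_int m) = h x"
proof -
  have nat: "h (x + 2 * pi * real k) = h x" for k x
  proof (induction k)
    case (Suc k)
    have "x + 2 * pi * real (Suc k) = (x + 2 * pi * real k) + 2 * pi" by (simp add: algebra_simps)
    then show ?case using Suc.IH assms[of "x + 2 * pi * real k"] by metis
  qed simp
  show ?thesis
  proof (cases "m \<ge> 0")
    case True
    then show ?thesis using nat[of x "nat m"] by simp
  next
    case False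
    then show ?thesis using nat[of "x + 2 * pi * real_of_int m" "nat (- m)"] by simp
  qed
qed

text \<open>
  The norms see only \<open>[-\<pi>, \<pi>]\<close>, whereas pointwise statements are made on the whole line; countably
  many translates of the interval cover the line.
\<close>

lemma AE_of_periodic:
  assumes per: "\<And>x. P (x + 2 * pi) = P x"
    and AE: "AE x in lebesgue. x \<in> {-pi..pi} \<longrightarrow> P x"
  shows "AE x in lebesgue. P x"
proof -
  have "AE x in lebesgue. \<forall>m::int. x + 2 * pi * real_of_int m \<in> {-pi..pi} \<longrightarrow> P (x + 2 * pi * real_of_int m)"
    unfolding AE_all_countable
  proof
    fix m :: int
    show "AE x in lebesgue. x + 2 * pi * real_of_int m \<in> {-pi..pi} \<longrightarrow> P (x + 2 * pi * real_of_int m)"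
      using AE_lebesgue_affine[OF AE, of 1 "2 * pi * real_of_int m"]
      by (simp only: mult_1 add.commute[of "2 * pi * real_of_int m"])
  qed
  then show ?thesis
  proof eventually_elim
    case (elim x)
    define m where "m = - \<lfloor>(x + pi) / (2 * pi)\<rfloor>"
    have "real_of_int \<lfloor>(x + pi) / (2 * pi)\<rfloor> \<le> (x + pi) / (2 * pi)"
      "(x + pi) / (2 * pi) < real_of_int \<lfloor>(x + pi) / (2 * pi)\<rfloor> + 1" by linarith+
    then have "- real_of_int m \<le> (x + pi) / (2 * pi)" "(x + pi) / (2 * pi) < - real_of_int m + 1"
      by (auto simp: m_def)
    then have "- real_of_int m * (2 * pi) \<le> x + pi" "x + pi < (- real_of_int m + 1) * (2 * pi)"
      by (auto simp: field_simps)
    then have "x + 2 * pi * real_of_int m \<in> {-pi..pi}" by (auto simp: algebra_simps)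
    then show ?case using elim periodic_shift_int[of P, OF per] by auto
  qed
qed

text \<open>
  The integral over \<open>[a, a + 2\<pi>)\<close> is unchanged when \<open>a\<close> moves by a multiple of \<open>2\<pi>\<close>, so \<open>a\<close> may be
  taken in \<open>[-\<pi>, \<pi>)\<close>; then the part beyond \<open>\<pi>\<close> is moved back by one period and fills \<open>[-\<pi>, a)\<close>.
\<close>

lemma nn_integral_periodic_shift:
  fixes h :: "real \<Rightarrow> ennreal"
  assumes h [measurable]: "h \<in> borel_measurable lebesgue" and per: "\<And>x. h (x + 2 * pi) = h x"
  shows "(\<integral>\<^sup>+x\<in>{-pi..pi}. h (c + x) \<partial>lebesgue) = (\<integral>\<^sup>+x\<in>{-pi..pi}. h x \<partial>lebesgue)"
proof -
  define J where "J a b = (\<integral>\<^sup>+x. h x * indicator {a..<b} x \<partial>lebesgue)" for a b :: real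
  have shift: "J a b = (\<integral>\<^sup>+x. h (s + x) * indicator {a - s..<b - s} x \<partial>lebesgue)" for a b s
    unfolding J_def
    by (subst nn_integral_real_affine_lebesgue[where c = 1 and t = s])
       (auto intro!: nn_integral_cong split: split_indicator)
  have per_J: "J a b = J (a - 2 * pi * real_of_int m) (b - 2 * pi * real_of_int m)" for a b m
    using periodic_shift_int[of h, OF per] unfolding shift[of a b "2 * pi * real_of_int m"]
    by (simp add: J_def add.commute)
  have split: "J a b = J a y + J y b" if "a \<le> y" "y \<le> b" for a y b
    unfolding J_def using that
    by (subst nn_integral_add[symmetric]) (auto intro!: nn_integral_cong split: split_indicator)
  have base: "J a (a + 2 * pi) = J (-pi) pi" if "-pi \<le> a" "a \<le> pi" for a
  proof -
    have "J a (a + 2 * pi) = J a pi + J pi (a + 2 * pi)" using that by (intro split) auto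
    also have "J pi (a + 2 * pi) = J (-pi) a" using per_J[of pi "a + 2 * pi" 1] by simp
    also have "J a pi + J (-pi) a = J (-pi) pi" using that split[of "-pi" a pi] by (simp add: add.commute)
    finally show ?thesis .
  qed
  have all: "J a (a + 2 * pi) = J (-pi) pi" for a
  proof -
    define m where "m = \<lfloor>(a + pi) / (2 * pi)\<rfloor>"
    have "real_of_int m \<le> (a + pi) / (2 * pi)" "(a + pi) / (2 * pi) < real_of_int m + 1"
      unfolding m_def by linarith+
    then have "real_of_int m * (2 * pi) \<le> a + pi" "a + pi < (real_of_int m + 1) * (2 * pi)"
      by (auto simp: field_simps)
    then have "J (a - 2 * pi * real_of_int m) (a - 2 * pi * real_of_int m + 2 * pi) = J (-pi) pi"
      by (intro base) (auto simp: algebra_simps)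
    then show ?thesis using per_J[of a "a + 2 * pi" m] by (simp add: algebra_simps)
  qed
  have closed: "(\<integral>\<^sup>+x. g x * indicator {a..b} x \<partial>lebesgue) = (\<integral>\<^sup>+x. g x * indicator {a..<b} x \<partial>lebesgue)"
    for g :: "real \<Rightarrow> ennreal" and a b
  proof (rule nn_integral_cong_AE)
    have "AE x in lebesgue. x \<noteq> b" by (rule AE_completion, rule AE_lborel_singleton)
    then show "AE x in lebesgue. g x * indicator {a..b} x = g x * indicator {a..<b} x"
      by eventually_elim (auto split: split_indicator)
  qed
  have "(\<integral>\<^sup>+x\<in>{-pi..pi}. h (c + x) \<partial>lebesgue) = J (c - pi) (c + pi)"
    unfolding closed shift[of "c - pi" "c + pi" c] by simp
  also have "\<dots> = J (-pi) pi" using all[of "c - pi"] by (simp add: algebra_simps)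
  finally show ?thesis unfolding closed J_def .
qed

lemma integral_periodic_shift:
  fixes h :: "real \<Rightarrow> real"
  assumes h [measurable]: "h \<in> borel_measurable lebesgue" and per: "\<And>x. h (x + 2 * pi) = h x"
    and int: "set_integrable lebesgue {-pi..pi} h"
  shows "set_integrable lebesgue {-pi..pi} (\<lambda>x. h (c + x))"
    and "(LINT x:{-pi..pi}|lebesgue. h (c + x)) = (LINT x:{-pi..pi}|lebesgue. h x)"
proof -
  have [measurable]: "(\<lambda>x. h (c + x)) \<in> borel_measurable lebesgue"
    using borel_measurable_affine[OF h, of 1 c] by simp
  have eq: "(\<integral>\<^sup>+x. ennreal (indicator {-pi..pi} x *\<^sub>R F (h (c + x))) \<partial>lebesgue)
      = (\<integral>\<^sup>+x. ennreal (indicator {-pi..pi} x *\<^sub>R F (h x)) \<partial>lebesgue)"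
    if [measurable]: "F \<in> borel_measurable borel" for F :: "real \<Rightarrow> real"
    using nn_integral_periodic_shift[of "\<lambda>x. ennreal (F (h x))" c] per
    by (simp add: nn_integral_set_ennreal mult.commute)
  show int': "set_integrable lebesgue {-pi..pi} (\<lambda>x. h (c + x))"
    using int eq[of abs] unfolding set_integrable_def integrable_iff_bounded
    by (simp add: abs_mult)
  show "(LINT x:{-pi..pi}|lebesgue. h (c + x)) = (LINT x:{-pi..pi}|lebesgue. h x)"
    using eq[of "\<lambda>x. x"] eq[of uminus] int int'
    unfolding set_lebesgue_integral_def set_integrable_def
    by (simp add: real_lebesgue_integral_def)
qed

lemma set_integrable_mult_bounded:
  fixes f g :: "real \<Rightarrow> real"
  assumes f: "set_integrable lebesgue A f" and g [measurable]: "g \<in> borel_measurable lebesgue"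
    and c: "\<And>t. \<bar>g t\<bar> \<le> c"
  shows "set_integrable lebesgue A (\<lambda>t. f t * g t)"
  unfolding set_integrable_def
proof (rule Bochner_Integration.integrable_bound)
  have f': "integrable lebesgue (\<lambda>t. indicator A t *\<^sub>R f t)" using f by (simp add: set_integrable_def)
  then show "integrable lebesgue (\<lambda>t. c * (indicator A t *\<^sub>R f t))" by simp
  have "(\<lambda>t. (indicator A t *\<^sub>R f t) * g t) \<in> borel_measurable lebesgue"
    using f' by measurable
  then show "(\<lambda>t. indicator A t *\<^sub>R (f t * g t)) \<in> borel_measurable lebesgue"
    by (simp add: mult.assoc)
  have "0 \<le> c" using c[of 0] by linarith
  then show "AE t in lebesgue. norm (indicator A t *\<^sub>R (f t * g t)) \<le> norm (c * (indicator A t *\<^sub>R f t))"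
    using c by (auto simp: abs_mult mult.commute[of c] intro!: AE_I2 mult_left_mono split: split_indicator)
qed

lemma symmetric_integral_fold:
  fixes g :: "real \<Rightarrow> real"
  assumes g: "set_integrable lebesgue {-pi..pi} g"
  shows "(LINT t:{-pi..pi}|lebesgue. g t) = (LINT t:{0<..pi}|lebesgue. g t + g (- t))"
proof -
  have right: "set_integrable lebesgue {0<..pi} g" and left: "set_integrable lebesgue {-pi..<0} g"
    by (rule set_integrable_subset[OF g]; force)+
  have refl: "set_integrable lebesgue {0<..pi} (\<lambda>t. g (- t))"
    "(LINT t:{-pi..<0}|lebesgue. g t) = (LINT t:{0<..pi}|lebesgue. g (- t))"
  proof -
    have ind: "indicator {-pi..<0} (- t) *\<^sub>R g (- t) = indicator {0<..pi} t *\<^sub>R g (- t)" for t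
      by (auto split: split_indicator)
    show "set_integrable lebesgue {0<..pi} (\<lambda>t. g (- t))"
      using lebesgue_integrable_real_affine[of "\<lambda>t. indicator {-pi..<0} t *\<^sub>R g t" "- 1" 0] left
      unfolding set_integrable_def mult_minus1 add_0 ind by simp
    show "(LINT t:{-pi..<0}|lebesgue. g t) = (LINT t:{0<..pi}|lebesgue. g (- t))"
      using lebesgue_integral_real_affine[of "- 1" "\<lambda>t. indicator {-pi..<0} t *\<^sub>R g t" 0]
      unfolding set_lebesgue_integral_def mult_minus1 add_0 ind by simp
  qed
  have "(LINT t:{-pi..pi}|lebesgue. g t) = (LINT t:{-pi..<0} \<union> {0<..pi}|lebesgue. g t)"
  proof (rule set_integral_cong_set[symmetric])
    show "set_borel_measurable lebesgue {-pi..pi} g"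
      using g by (auto simp: set_borel_measurable_def set_integrable_def)
    have "set_integrable lebesgue ({-pi..<0} \<union> {0<..pi}) g"
      using left right by (rule set_integrable_Un) auto
    then show "set_borel_measurable lebesgue ({-pi..<0} \<union> {0<..pi}) g"
      by (auto simp: set_borel_measurable_def set_integrable_def)
    have "AE t in lebesgue. t \<noteq> (0::real)" by (rule AE_completion, rule AE_lborel_singleton)
    then show "AE t in lebesgue. (t \<in> {-pi..pi}) = (t \<in> {-pi..<0} \<union> {0<..pi})"
      by eventually_elim auto
  qed
  also have "\<dots> = (LINT t:{-pi..<0}|lebesgue. g t) + (LINT t:{0<..pi}|lebesgue. g t)"
    using left right by (intro set_integral_Un) auto
  also have "\<dots> = (LINT t:{0<..pi}|lebesgue. g t + g (- t))"
    using right refl by (simp add: set_integral_add add.commute)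
  finally show ?thesis .
qed

lemma conj_dirichlet_periodic: "conj_dirichlet k (t + 2 * pi) = conj_dirichlet k t"
proof -
  have "sin (real \<nu> * (t + 2 * pi)) = sin (real \<nu> * t)" for \<nu>
  proof -
    have "real \<nu> * (t + 2 * pi) = real \<nu> * t + 2 * pi * real \<nu>" by (simp add: algebra_simps)
    then show ?thesis using sin.plus_of_nat[of "real \<nu> * t" \<nu>] by (simp add: mult_ac)
  qed
  then show ?thesis by (simp add: conj_dirichlet_def)
qed

lemma conj_dirichlet_minus: "conj_dirichlet k (- t) = - conj_dirichlet k t"
  by (simp add: conj_dirichlet_def sum_negf)

lemma borel_measurable_conj_dirichlet [measurable]: "conj_dirichlet k \<in> borel_measurable borel"
  unfolding conj_dirichlet_def by measurable

locale periodic_integrable =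
  fixes f :: "real \<Rightarrow> real"
  assumes periodic: "f (x + 2 * pi) = f x"
    and measurable [measurable]: "f \<in> borel_measurable lebesgue"
    and integrable: "set_integrable lebesgue {-pi..pi} f"
begin

lemma measurable_affine: "c \<noteq> 0 \<Longrightarrow> (\<lambda>t. f (x + c * t)) \<in> borel_measurable lebesgue"
  using borel_measurable_affine[OF measurable, of c x] by simp

lemma measurable_shift [measurable]: "(\<lambda>t. f (x + t)) \<in> borel_measurable lebesgue"
  "(\<lambda>t. f (x - t)) \<in> borel_measurable lebesgue" "(\<lambda>x. f (x + t)) \<in> borel_measurable lebesgue"
  "(\<lambda>x. f (x - t)) \<in> borel_measurable lebesgue"
  using measurable_affine[of 1 x] measurable_affine[of "-1" x]
    measurable_affine[of 1 t] measurable_affine[of 1 "- t"] by (simp_all add: add.commute)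

lemma measurable_psi [measurable]: "psi f x \<in> borel_measurable lebesgue"
  "(\<lambda>x. psi f x t) \<in> borel_measurable lebesgue"
  unfolding psi_def[abs_def] by measurable

lemma integrable_shift: "set_integrable lebesgue {-pi..pi} (\<lambda>t. f (x + t))"
  using periodic integrable by (intro integral_periodic_shift) auto

lemma integrable_psi: "set_integrable lebesgue {0<..pi} (psi f x)"
proof -
  have "integrable lebesgue (\<lambda>t. indicator {-pi..pi} t *\<^sub>R f (x + t))"
    using integrable_shift by (simp add: set_integrable_def)
  from lebesgue_integrable_real_affine[OF this, of "-1" 0]
  have "integrable lebesgue (\<lambda>t. indicator {-pi..pi} (- t) *\<^sub>R f (x - t))" by simp
  moreover have "indicator {-pi..pi} (- t) = (indicator {-pi..pi} t :: real)" for t :: real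
    by (auto split: split_indicator)
  ultimately have "set_integrable lebesgue {-pi..pi} (\<lambda>t. f (x - t))"
    by (simp add: set_integrable_def)
  then have "set_integrable lebesgue {-pi..pi} (psi f x)"
    unfolding psi_def[abs_def] by (intro set_integral_diff integrable_shift)
  then show ?thesis by (rule set_integrable_subset) auto
qed

text \<open>
  The addition theorem turns the sum into a convolution with the kernel over a full period; as the
  kernel is odd, folding the period onto \<open>(0, \<pi>]\<close> produces the difference \<open>\<psi>\<^sub>x\<close>.
\<close>

lemma conj_partial_sum_eq_integral:
  "conj_partial_sum f k x = - (1 / pi) * (LINT t:{0<..pi}|lebesgue. psi f x t * conj_dirichlet k t)"
proof -
  have fg: "set_integrable lebesgue {-pi..pi} (\<lambda>t. f t * g t)"
    if "g \<in> borel_measurable lebesgue" "\<And>t. \<bar>g t\<bar> \<le> c" for g c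
    using integrable that by (rule set_integrable_mult_bounded)
  have term_eq: "fourier_a f \<nu> * sin (real \<nu> * x) - fourier_b f \<nu> * cos (real \<nu> * x)
      = 1 / pi * (LINT t:{-pi..pi}|lebesgue. f t * sin (real \<nu> * (x - t)))" for \<nu>
  proof -
    have c: "set_integrable lebesgue {-pi..pi} (\<lambda>t. f t * cos (real \<nu> * t))"
      and s: "set_integrable lebesgue {-pi..pi} (\<lambda>t. f t * sin (real \<nu> * t))"
      by (auto intro!: fg[where c = 1] borel_measurable_lebesgueI)
    have "(LINT t:{-pi..pi}|lebesgue. f t * sin (real \<nu> * (x - t)))
        = (LINT t:{-pi..pi}|lebesgue. (f t * cos (real \<nu> * t)) * sin (real \<nu> * x)
             - (f t * sin (real \<nu> * t)) * cos (real \<nu> * x))"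
      by (simp add: right_diff_distrib sin_diff mult_ac)
    also have "\<dots> = (LINT t:{-pi..pi}|lebesgue. f t * cos (real \<nu> * t)) * sin (real \<nu> * x)
        - (LINT t:{-pi..pi}|lebesgue. f t * sin (real \<nu> * t)) * cos (real \<nu> * x)"
      using c s by (subst set_integral_diff) auto
    finally show ?thesis by (simp add: fourier_a_def fourier_b_def diff_divide_distrib)
  qed
  define h where "h t = f t * conj_dirichlet k (x - t)" for t
  have [measurable]: "h \<in> borel_measurable lebesgue" unfolding h_def by measurable
  have h_int: "set_integrable lebesgue {-pi..pi} h"
    unfolding h_def by (rule fg[where c = "real k"]) (auto simp: abs_conj_dirichlet_le intro!: borel_measurable_lebesgueI)
  have h_per: "h (t + 2 * pi) = h t" for t
    unfolding h_def using periodic[of t] conj_dirichlet_periodic[of k "x - t - 2 * pi"] 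
    by (simp add: algebra_simps)
  have "conj_partial_sum f k x
      = 1 / pi * (\<Sum>\<nu>=1..k. LINT t:{-pi..pi}|lebesgue. f t * sin (real \<nu> * (x - t)))"
    unfolding conj_partial_sum_def term_eq by (rule sum_distrib_left[symmetric])
  also have "(\<Sum>\<nu>=1..k. LINT t:{-pi..pi}|lebesgue. f t * sin (real \<nu> * (x - t)))
      = (LINT t:{-pi..pi}|lebesgue. h t)"
  proof -
    have "set_integrable lebesgue {-pi..pi} (\<lambda>t. f t * sin (real \<nu> * (x - t)))" for \<nu>
      by (rule fg[where c = 1]) (auto intro!: borel_measurable_lebesgueI)
    then show ?thesis
      unfolding h_def conj_dirichlet_def set_lebesgue_integral_def set_integrable_def
      by (subst Bochner_Integration.integral_sum[symmetric]) (auto simp: sum_distrib_left)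
  qed
  also have "\<dots> = (LINT t:{-pi..pi}|lebesgue. h (x + t))"
    using h_per h_int by (intro integral_periodic_shift(2)[symmetric]) auto
  also have "\<dots> = (LINT t:{0<..pi}|lebesgue. h (x + t) + h (x + - t))"
    using h_per h_int by (intro symmetric_integral_fold integral_periodic_shift) auto
  also have "\<dots> = (LINT t:{0<..pi}|lebesgue. - (psi f x t * conj_dirichlet k t))"
    by (simp add: h_def psi_def conj_dirichlet_minus algebra_simps)
  also have "\<dots> = - (LINT t:{0<..pi}|lebesgue. psi f x t * conj_dirichlet k t)"
    by (simp add: set_lebesgue_integral_def)
  finally show ?thesis by simp
qed

text \<open>
  Summation and integration are interchanged by dominated convergence. The majorant \<open>B\<close> is left open
  since two different ones are needed: \<open>\<pi>/t\<close>, which is admissible only where \<open>\<psi>\<^sub>x(t)/t\<close> is integrable,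
  and the constant \<open>\<Sum>\<^sub>k (k + 1) a\<^sub>k\<close>, which is admissible at every \<open>x\<close>.
\<close>

lemma conj_mean_sums:
  fixes a :: "nat \<Rightarrow> real" and B :: "real \<Rightarrow> real"
  assumes a: "\<And>k. 0 \<le> a k" "a sums 1"
    and B: "\<And>N t. 0 < t \<Longrightarrow> t \<le> pi \<Longrightarrow> (\<Sum>k<N. \<bar>a k * conj_dirichlet k t\<bar>) \<le> B t"
    and int: "set_integrable lebesgue {0<..pi} (\<lambda>t. psi f x t * B t)"
  defines "Q \<equiv> \<lambda>t. 1 / 2 * cot (t / 2) - mean_kernel a t / (2 * sin (t / 2))"
  shows "(\<lambda>k. a k * conj_partial_sum f k x) sums
           (- (1 / pi) * (LINT t:{0<..pi}|lebesgue. psi f x t * Q t))"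
    and "set_integrable lebesgue {0<..pi} (\<lambda>t. psi f x t * Q t)"
proof -
  have Q_borel: "Q \<in> borel_measurable borel" unfolding Q_def cot_def by measurable
  note [measurable] = borel_measurable_lebesgueI[OF Q_borel]
  define s where "s N t = indicator {0<..pi} t *\<^sub>R (psi f x t * (\<Sum>k<N. a k * conj_dirichlet k t))" for N t
  have term_int: "set_integrable lebesgue {0<..pi} (\<lambda>t. psi f x t * conj_dirichlet k t)" for k
    using integrable_psi by (rule set_integrable_mult_bounded[where c = "real k"])
      (auto simp: abs_conj_dirichlet_le intro!: borel_measurable_lebesgueI)
  have s_int: "(\<integral>t. s N t \<partial>lebesgue) = - pi * (\<Sum>k<N. a k * conj_partial_sum f k x)" for N
  proof -
    have "(\<integral>t. s N t \<partial>lebesgue)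
        = (\<integral>t. (\<Sum>k<N. a k * (indicator {0<..pi} t *\<^sub>R (psi f x t * conj_dirichlet k t))) \<partial>lebesgue)"
      unfolding s_def by (simp add: sum_distrib_left mult_ac)
    also have "\<dots> = (\<Sum>k<N. a k * (LINT t:{0<..pi}|lebesgue. psi f x t * conj_dirichlet k t))"
      using term_int unfolding set_integrable_def set_lebesgue_integral_def
      by (subst Bochner_Integration.integral_sum) auto
    also have "\<dots> = (\<Sum>k<N. - pi * (a k * conj_partial_sum f k x))"
      unfolding conj_partial_sum_eq_integral by (intro sum.cong) auto
    finally show ?thesis by (simp only: sum_distrib_left)
  qed
  have w: "integrable lebesgue (\<lambda>t. \<bar>indicator {0<..pi} t *\<^sub>R (psi f x t * B t)\<bar>)"
    using int by (auto simp: set_integrable_def)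
  have lim: "(\<lambda>N. s N t) \<longlonglongrightarrow> indicator {0<..pi} t *\<^sub>R (psi f x t * Q t)" for t
  proof (cases "t \<in> {0<..pi}")
    case True
    then have "(\<lambda>k. a k * conj_dirichlet k t) sums Q t"
      unfolding Q_def using a by (intro sums_conj_dirichlet) auto
    then show ?thesis using True unfolding s_def sums_def by (auto intro!: tendsto_intros)
  qed (simp add: s_def)
  have bound: "norm (s N t) \<le> \<bar>indicator {0<..pi} t *\<^sub>R (psi f x t * B t)\<bar>" for N t
  proof (cases "t \<in> {0<..pi}")
    case True
    have "\<bar>\<Sum>k<N. a k * conj_dirichlet k t\<bar> \<le> (\<Sum>k<N. \<bar>a k * conj_dirichlet k t\<bar>)" by (rule sum_abs)
    also have "\<dots> \<le> B t" using True by (intro B) auto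
    also have "\<dots> \<le> \<bar>B t\<bar>" by simp
    finally show ?thesis using True by (simp add: s_def abs_mult mult_left_mono)
  qed (simp add: s_def)
  have meas: "(\<lambda>t. indicator {0<..pi} t *\<^sub>R (psi f x t * Q t)) \<in> borel_measurable lebesgue"
    "\<And>N. s N \<in> borel_measurable lebesgue"
    unfolding s_def by measurable
  show "set_integrable lebesgue {0<..pi} (\<lambda>t. psi f x t * Q t)"
    unfolding set_integrable_def
    by (rule integrable_dominated_convergence[where s = s, OF meas w])
      (use lim bound in auto)
  have "(\<lambda>N. \<integral>t. s N t \<partial>lebesgue) \<longlonglongrightarrow> (LINT t:{0<..pi}|lebesgue. psi f x t * Q t)"
    unfolding set_lebesgue_integral_def
    by (rule integral_dominated_convergence[where s = s, OF meas w])
      (use lim bound in auto)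
  then have "(\<lambda>N. - (1 / pi) * (\<integral>t. s N t \<partial>lebesgue)) \<longlonglongrightarrow> - (1 / pi) * (LINT t:{0<..pi}|lebesgue. psi f x t * Q t)"
    by (rule tendsto_mult_left)
  then show "(\<lambda>k. a k * conj_partial_sum f k x) sums
           (- (1 / pi) * (LINT t:{0<..pi}|lebesgue. psi f x t * Q t))"
    unfolding s_int sums_def by simp
qed

end

section \<open>Minkowski's integral inequality\<close>

text \<open>
  The tangent of the convex function \<open>y\<^sup>p\<close> at \<open>c\<close>. Integrated against a probability measure, and
  with \<open>c\<close> equal to the mean of \<open>y\<close>, it becomes Jensen's inequality; with \<open>c = 1\<close> it shows that the mean is
  finite whenever the mean of \<open>y\<^sup>p\<close> is.
\<close>

lemma powr_tangent:
  fixes y c p :: real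
  assumes p: "1 \<le> p" and y: "0 \<le> y" and c: "0 < c"
  shows "p * c powr (p - 1) * y \<le> y powr p + (p - 1) * c powr p"
proof (cases "y = 0")
  case True
  then show ?thesis using p by simp
next
  case False
  have "p * c powr (p - 1) * (y - c) \<le> y powr p - c powr p"
  proof (rule convex_on_imp_above_tangent[where A = "{0<..}"])
    show "convex_on {0<..} (\<lambda>x. x powr p)" using p by (rule powr_convex)
    show "((\<lambda>x. x powr p) has_field_derivative p * c powr (p - 1)) (at c within {0<..})"
      using c by (auto intro!: derivative_eq_intros)
  qed (use c y False in \<open>auto simp: interior_open\<close>)
  moreover have "p * c powr (p - 1) * c = p * c powr p"
    using c by (simp add: powr_diff)
  ultimately show ?thesis unfolding right_diff_distrib left_diff_distrib by simp
qed

context pair_sigma_finite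
begin

text \<open>
  Jensen's inequality for the measure with density \<open>w \<kappa>\<close>, whose mass is at most \<open>M\<close>, and the function
  \<open>F/w\<close> bounds the \<open>p\<close>-th power of \<open>Y(x) = \<integral> F(x,t) \<kappa>(t) dt\<close> by
  \<open>M\<^sup>p\<^sup>-\<^sup>1 P(x)\<close> with \<open>P(x) = \<integral> (F(x,t)/w(t))\<^sup>p w(t) \<kappa>(t) dt\<close>. After integration in \<open>x\<close> and an exchange of
  the integrals, the assumption on the norms makes \<open>w\<close> cancel in \<open>P\<close>, which leaves at most \<open>M\<close>.
\<close>

lemma Minkowski_integral_inequality_pos:
  fixes F :: "'a \<Rightarrow> 'b \<Rightarrow> real" and w \<kappa> :: "'b \<Rightarrow> real"
  assumes F [measurable]: "case_prod F \<in> borel_measurable (M1 \<Otimes>\<^sub>M M2)"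
    and w [measurable]: "w \<in> borel_measurable M2" and \<kappa> [measurable]: "\<kappa> \<in> borel_measurable M2"
    and F_nonneg: "\<And>x t. 0 \<le> F x t" and w_pos: "\<And>t. t \<in> space M2 \<Longrightarrow> 0 < w t" and \<kappa>_nonneg: "\<And>t. 0 \<le> \<kappa> t"
    and p: "1 \<le> p" and M: "0 < M"
    and norm_le: "\<And>t. t \<in> space M2 \<Longrightarrow> (\<integral>\<^sup>+x. ennreal (F x t powr p) \<partial>M1) \<le> ennreal (w t powr p)"
    and weight: "(\<integral>\<^sup>+t. ennreal (w t * \<kappa> t) \<partial>M2) \<le> ennreal M"
  shows "AE x in M1. (\<integral>\<^sup>+t. ennreal (F x t * \<kappa> t) \<partial>M2) < \<infinity>"
    and "(\<integral>\<^sup>+x. ennreal (enn2real (\<integral>\<^sup>+t. ennreal (F x t * \<kappa> t) \<partial>M2) powr p) \<partial>M1) \<le> ennreal (M powr p)"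
proof -
  define P where "P x = (\<integral>\<^sup>+t. ennreal ((F x t / w t) powr p * (w t * \<kappa> t)) \<partial>M2)" for x
  define Y where "Y x = (\<integral>\<^sup>+t. ennreal (F x t * \<kappa> t) \<partial>M2)" for x
  have [measurable]: "P \<in> borel_measurable M1" unfolding P_def by measurable
  have [measurable]: "Y \<in> borel_measurable M1" unfolding Y_def by measurable
  have P_int: "(\<integral>\<^sup>+x. P x \<partial>M1) \<le> ennreal M"
  proof -
    have "(\<integral>\<^sup>+x. P x \<partial>M1) = (\<integral>\<^sup>+t. (\<integral>\<^sup>+x. ennreal ((F x t / w t) powr p * (w t * \<kappa> t)) \<partial>M1) \<partial>M2)"
      unfolding P_def by (subst Fubini') auto
    also have "\<dots> \<le> (\<integral>\<^sup>+t. ennreal (w t * \<kappa> t) \<partial>M2)"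
    proof (rule nn_integral_mono)
      fix t assume t: "t \<in> space M2"
      have [measurable]: "(\<lambda>x. F x t) \<in> borel_measurable M1"
        using measurable_compose[OF measurable_Pair2'[OF t] F] by simp
      have wt: "0 < w t" using t by (rule w_pos)
      have eq: "(F x t / w t) powr p * (w t * \<kappa> t) = w t * \<kappa> t / w t powr p * F x t powr p" for x
        using wt F_nonneg[of x t] by (simp add: powr_divide)
      have "(\<integral>\<^sup>+x. ennreal ((F x t / w t) powr p * (w t * \<kappa> t)) \<partial>M1)
          = ennreal (w t * \<kappa> t / w t powr p) * (\<integral>\<^sup>+x. ennreal (F x t powr p) \<partial>M1)"
        unfolding eq using wt \<kappa>_nonneg by (subst ennreal_mult) (auto intro!: nn_integral_cmult)
      also have "\<dots> \<le> ennreal (w t * \<kappa> t / w t powr p) * ennreal (w t powr p)"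
        by (rule mult_left_mono[OF norm_le[OF t]]) simp
      also have "\<dots> = ennreal (w t * \<kappa> t)"
        using wt \<kappa>_nonneg[of t] by (subst ennreal_mult[symmetric]) auto
      finally show "(\<integral>\<^sup>+x. ennreal ((F x t / w t) powr p * (w t * \<kappa> t)) \<partial>M1) \<le> ennreal (w t * \<kappa> t)" .
    qed
    also note weight
    finally show ?thesis .
  qed
  have tangent: "ennreal (p * c powr (p - 1)) * Y x \<le> P x + ennreal ((p - 1) * c powr p * M)"
    if x: "x \<in> space M1" and c: "0 < c" for x c
  proof -
    have [measurable]: "F x \<in> borel_measurable M2"
      using measurable_compose_Pair1[OF x F] by simp
    have "ennreal (p * c powr (p - 1)) * Y x = (\<integral>\<^sup>+t. ennreal (p * c powr (p - 1)) * ennreal (F x t * \<kappa> t) \<partial>M2)"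
      unfolding Y_def by (rule nn_integral_cmult[symmetric]) simp
    also have "\<dots> \<le> (\<integral>\<^sup>+t. ennreal ((F x t / w t) powr p * (w t * \<kappa> t))
          + ennreal ((p - 1) * c powr p) * ennreal (w t * \<kappa> t) \<partial>M2)"
    proof (rule nn_integral_mono)
      fix t assume "t \<in> space M2"
      then have wt: "0 < w t" by (rule w_pos)
      have "p * c powr (p - 1) * (F x t / w t) * (w t * \<kappa> t)
          \<le> ((F x t / w t) powr p + (p - 1) * c powr p) * (w t * \<kappa> t)"
        using wt F_nonneg[of x t] \<kappa>_nonneg[of t] p c
        by (intro mult_right_mono powr_tangent) auto
      moreover have "p * c powr (p - 1) * (F x t / w t) * (w t * \<kappa> t) = p * c powr (p - 1) * (F x t * \<kappa> t)"
        using wt by simp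
      ultimately have "p * c powr (p - 1) * (F x t * \<kappa> t)
          \<le> (F x t / w t) powr p * (w t * \<kappa> t) + (p - 1) * c powr p * (w t * \<kappa> t)"
        by (simp only: distrib_right)
      then have "ennreal (p * c powr (p - 1) * (F x t * \<kappa> t))
          \<le> ennreal ((F x t / w t) powr p * (w t * \<kappa> t) + (p - 1) * c powr p * (w t * \<kappa> t))"
        by (rule ennreal_leI)
      then show "ennreal (p * c powr (p - 1)) * ennreal (F x t * \<kappa> t)
          \<le> ennreal ((F x t / w t) powr p * (w t * \<kappa> t)) + ennreal ((p - 1) * c powr p) * ennreal (w t * \<kappa> t)"
        using p wt F_nonneg[of x t] \<kappa>_nonneg[of t] by (simp add: ennreal_mult ennreal_plus)
    qed
    also have "\<dots> = P x + ennreal ((p - 1) * c powr p) * (\<integral>\<^sup>+t. ennreal (w t * \<kappa> t) \<partial>M2)"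
      unfolding P_def by (subst nn_integral_add) (auto simp: nn_integral_cmult)
    also have "\<dots> \<le> P x + ennreal ((p - 1) * c powr p) * ennreal M"
      by (intro add_left_mono mult_left_mono weight) simp
    also have "\<dots> = P x + ennreal ((p - 1) * c powr p * M)"
      using p M by (subst ennreal_mult[symmetric]) auto
    finally show ?thesis .
  qed
  \<comment> \<open>Already the tangent at \<open>1\<close> shows that \<open>Y\<close> is finite where \<open>P\<close> is.\<close>
  have fin: "Y x < \<infinity>" if x: "x \<in> space M1" and Px: "P x < \<infinity>" for x
  proof -
    have "P x + ennreal ((p - 1) * 1 powr p * M) < \<infinity>" using Px by simp
    then have "ennreal (p * 1 powr (p - 1)) * Y x < \<infinity>"
      using tangent[OF x, of 1] by (rule order.strict_trans1[rotated]) simp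
    then show ?thesis using p by (auto simp: ennreal_mult_less_top)
  qed
  have power: "ennreal (enn2real (Y x) powr p) \<le> ennreal (M powr p / M) * P x"
    if x: "x \<in> space M1" and Px: "P x < \<infinity>" for x
  proof (cases "enn2real (Y x) = 0")
    case True
    then show ?thesis using p by simp
  next
    case False
    define y where "y = enn2real (Y x)"
    \<comment> \<open>The mean of \<open>F/w\<close> when the weight has mass exactly \<open>M\<close>; the tangent there is the sharpest one.\<close>
    define c where "c = y / M"
    define q where "q = enn2real (P x)"
    have y: "0 < y" using False enn2real_nonneg[of "Y x"] unfolding y_def by linarith
    then have c: "0 < c" using M by (simp add: c_def)
    have Y_eq: "Y x = ennreal y" and P_eq: "P x = ennreal q" and q: "0 \<le> q"
      using fin[OF x Px] Px by (auto simp: y_def q_def)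
    have "ennreal (p * c powr (p - 1) * y) \<le> ennreal (q + (p - 1) * c powr p * M)"
      using tangent[OF x c] p y q M unfolding Y_eq P_eq
      by (simp add: ennreal_mult ennreal_plus)
    then have "p * c powr (p - 1) * y \<le> q + (p - 1) * c powr p * M"
      using p q M by (subst (asm) ennreal_le_iff) auto
    moreover have "c powr (p - 1) * y = c powr p * M"
    proof -
      have "c powr (p - 1) * c = c powr p" using c by (simp add: powr_diff)
      moreover have "y = c * M" using M by (simp add: c_def)
      ultimately show ?thesis by (metis mult.assoc)
    qed
    ultimately have "c powr p * M \<le> q" by (simp add: algebra_simps)
    then have "y powr p \<le> M powr p / M * q"
      using y M by (simp add: c_def powr_divide field_simps)
    then have "ennreal (y powr p) \<le> ennreal (M powr p / M * q)" by (rule ennreal_leI)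
    then show ?thesis using M q unfolding P_eq y_def[symmetric] by (subst ennreal_mult[symmetric]) auto
  qed
  have AE_P: "AE x in M1. P x < \<infinity>"
  proof -
    have "(\<integral>\<^sup>+x. P x \<partial>M1) \<noteq> \<infinity>" using P_int by (auto simp: top_unique)
    then have "AE x in M1. P x \<noteq> \<infinity>" by (rule nn_integral_PInf_AE[rotated]) measurable
    then show ?thesis by eventually_elim (simp add: less_top)
  qed
  show "AE x in M1. (\<integral>\<^sup>+t. ennreal (F x t * \<kappa> t) \<partial>M2) < \<infinity>"
    using AE_P fin unfolding Y_def[symmetric] by auto
  have "(\<integral>\<^sup>+x. ennreal (enn2real (Y x) powr p) \<partial>M1) \<le> (\<integral>\<^sup>+x. ennreal (M powr p / M) * P x \<partial>M1)"
    using AE_P power by (intro nn_integral_mono_AE) auto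
  also have "\<dots> = ennreal (M powr p / M) * (\<integral>\<^sup>+x. P x \<partial>M1)" by (rule nn_integral_cmult) simp
  also have "\<dots> \<le> ennreal (M powr p / M) * ennreal M" by (intro mult_left_mono P_int) simp
  also have "\<dots> = ennreal (M powr p)" using M by (subst ennreal_mult[symmetric]) auto
  finally show "(\<integral>\<^sup>+x. ennreal (enn2real (\<integral>\<^sup>+t. ennreal (F x t * \<kappa> t) \<partial>M2) powr p) \<partial>M1) \<le> ennreal (M powr p)"
    unfolding Y_def .
qed

text \<open>
  To admit zeros of \<open>w\<close>, the previous lemma is applied to \<open>w + \<eta> h\<close> with \<open>\<eta> \<rightarrow> 0\<close>, where \<open>h\<close> is a strictly
  positive function such that \<open>h \<kappa>\<close> is integrable. It exists because the measure is sigma-finite: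
  divide a positive integrable function by \<open>1 + \<kappa>\<close>.
\<close>

theorem Minkowski_integral_inequality:
  fixes F :: "'a \<Rightarrow> 'b \<Rightarrow> real" and w \<kappa> :: "'b \<Rightarrow> real"
  assumes F [measurable]: "case_prod F \<in> borel_measurable (M1 \<Otimes>\<^sub>M M2)"
    and w [measurable]: "w \<in> borel_measurable M2" and \<kappa> [measurable]: "\<kappa> \<in> borel_measurable M2"
    and F_nonneg: "\<And>x t. 0 \<le> F x t" and w_nonneg: "\<And>t. 0 \<le> w t" and \<kappa>_nonneg: "\<And>t. 0 \<le> \<kappa> t"
    and p: "1 \<le> p" and M: "0 \<le> M"
    and norm_le: "\<And>t. t \<in> space M2 \<Longrightarrow> (\<integral>\<^sup>+x. ennreal (F x t powr p) \<partial>M1) \<le> ennreal (w t powr p)"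
    and weight: "(\<integral>\<^sup>+t. ennreal (w t * \<kappa> t) \<partial>M2) \<le> ennreal M"
  shows "AE x in M1. (\<integral>\<^sup>+t. ennreal (F x t * \<kappa> t) \<partial>M2) < \<infinity>"
    and "(\<integral>\<^sup>+x. ennreal (enn2real (\<integral>\<^sup>+t. ennreal (F x t * \<kappa> t) \<partial>M2) powr p) \<partial>M1) \<le> ennreal (M powr p)"
proof -
  obtain h0 where h0 [measurable]: "h0 \<in> borel_measurable M2" and h0_int: "integral\<^sup>N M2 h0 \<noteq> \<infinity>"
    and h0_pos: "\<And>t. t \<in> space M2 \<Longrightarrow> 0 < h0 t \<and> h0 t < \<infinity>"
    using M2.Ex_finite_integrable_function by blast
  define h where "h t = enn2real (h0 t) / (1 + \<kappa> t)" for t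
  define L where "L = enn2real (integral\<^sup>N M2 h0)"
  have [measurable]: "h \<in> borel_measurable M2" unfolding h_def by measurable
  have h_pos: "0 < h t" if "t \<in> space M2" for t
    using h0_pos[OF that] \<kappa>_nonneg[of t] by (auto simp: h_def enn2real_positive_iff add_pos_nonneg)
  have h_weight: "(\<integral>\<^sup>+t. ennreal (h t * \<kappa> t) \<partial>M2) \<le> ennreal L"
  proof -
    have "(\<integral>\<^sup>+t. ennreal (h t * \<kappa> t) \<partial>M2) \<le> integral\<^sup>N M2 h0"
    proof (rule nn_integral_mono)
      fix t assume t: "t \<in> space M2"
      have "\<kappa> t / (1 + \<kappa> t) \<le> 1" using \<kappa>_nonneg[of t] by simp
      then have "enn2real (h0 t) * (\<kappa> t / (1 + \<kappa> t)) \<le> enn2real (h0 t)"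
        by (intro mult_left_le) auto
      then have "ennreal (h t * \<kappa> t) \<le> ennreal (enn2real (h0 t))"
        by (intro ennreal_leI) (simp add: h_def)
      also have "ennreal (enn2real (h0 t)) = h0 t" using h0_pos[OF t] by simp
      finally show "ennreal (h t * \<kappa> t) \<le> h0 t" .
    qed
    then show ?thesis using h0_int by (simp add: L_def less_top)
  qed
  have perturbed:
    "AE x in M1. (\<integral>\<^sup>+t. ennreal (F x t * \<kappa> t) \<partial>M2) < \<infinity>"
    "(\<integral>\<^sup>+x. ennreal (enn2real (\<integral>\<^sup>+t. ennreal (F x t * \<kappa> t) \<partial>M2) powr p) \<partial>M1)
       \<le> ennreal ((M + \<eta> * (L + 1)) powr p)" if \<eta>: "0 < \<eta>" for \<eta>
  proof -
    have L: "0 \<le> L" by (simp add: L_def)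
    have pos: "0 < w t + \<eta> * h t" if "t \<in> space M2" for t
      using w_nonneg[of t] h_pos[OF that] \<eta> by (simp add: add_nonneg_pos)
    have le: "(\<integral>\<^sup>+x. ennreal (F x t powr p) \<partial>M1) \<le> ennreal ((w t + \<eta> * h t) powr p)" if t: "t \<in> space M2" for t
      using w_nonneg[of t] h_pos[OF t] \<eta> p
      by (intro order_trans[OF norm_le[OF t]] ennreal_leI powr_mono2) auto
    have "(\<integral>\<^sup>+t. ennreal ((w t + \<eta> * h t) * \<kappa> t) \<partial>M2)
        = (\<integral>\<^sup>+t. ennreal (w t * \<kappa> t) + ennreal \<eta> * ennreal (h t * \<kappa> t) \<partial>M2)"
    proof (rule nn_integral_cong)
      fix t assume "t \<in> space M2"
      then show "ennreal ((w t + \<eta> * h t) * \<kappa> t) = ennreal (w t * \<kappa> t) + ennreal \<eta> * ennreal (h t * \<kappa> t)"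
        using w_nonneg[of t] \<kappa>_nonneg[of t] h_pos[of t] \<eta>
        by (subst ennreal_mult[symmetric]) (auto simp: distrib_right mult.assoc simp flip: ennreal_plus)
    qed
    also have "\<dots> = (\<integral>\<^sup>+t. ennreal (w t * \<kappa> t) \<partial>M2) + ennreal \<eta> * (\<integral>\<^sup>+t. ennreal (h t * \<kappa> t) \<partial>M2)"
      by (subst nn_integral_add) (auto simp: nn_integral_cmult)
    also have "\<dots> \<le> ennreal M + ennreal \<eta> * ennreal L"
      by (intro add_mono weight mult_left_mono h_weight) simp
    also have "\<dots> = ennreal (M + \<eta> * L)"
      using M L \<eta> by (simp add: ennreal_mult ennreal_plus)
    also have "\<dots> \<le> ennreal (M + \<eta> * (L + 1))" using \<eta> by (intro ennreal_leI) simp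
    finally have weight': "(\<integral>\<^sup>+t. ennreal ((w t + \<eta> * h t) * \<kappa> t) \<partial>M2) \<le> ennreal (M + \<eta> * (L + 1))" .
    have M': "0 < M + \<eta> * (L + 1)" using M \<eta> L by (simp add: add_nonneg_pos)
    have w': "(\<lambda>t. w t + \<eta> * h t) \<in> borel_measurable M2" by measurable
    show "AE x in M1. (\<integral>\<^sup>+t. ennreal (F x t * \<kappa> t) \<partial>M2) < \<infinity>"
      "(\<integral>\<^sup>+x. ennreal (enn2real (\<integral>\<^sup>+t. ennreal (F x t * \<kappa> t) \<partial>M2) powr p) \<partial>M1)
       \<le> ennreal ((M + \<eta> * (L + 1)) powr p)"
      using Minkowski_integral_inequality_pos[OF F w' \<kappa> F_nonneg pos \<kappa>_nonneg p M' le weight'] by auto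
  qed
  show "AE x in M1. (\<integral>\<^sup>+t. ennreal (F x t * \<kappa> t) \<partial>M2) < \<infinity>"
    by (rule perturbed(1)[of 1]) simp
  show "(\<integral>\<^sup>+x. ennreal (enn2real (\<integral>\<^sup>+t. ennreal (F x t * \<kappa> t) \<partial>M2) powr p) \<partial>M1) \<le> ennreal (M powr p)"
  proof (rule tendsto_lowerbound)
    have "((\<lambda>\<eta>. (M + \<eta> * (L + 1)) powr p) \<longlongrightarrow> (M + 0 * (L + 1)) powr p) (at_right 0)"
    proof (rule tendsto_powr')
      have "eventually (\<lambda>\<eta>::real. 0 < \<eta>) (at_right 0)" by (rule eventually_at_right_less)
      then have "eventually (\<lambda>\<eta>. 0 \<le> M + \<eta> * (L + 1)) (at_right 0)"
        by eventually_elim (use M in \<open>simp add: L_def\<close>)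
      then show "M + 0 * (L + 1) \<noteq> 0 \<or> 0 < p \<and> (\<forall>\<^sub>F \<eta> in at_right 0. 0 \<le> M + \<eta> * (L + 1))"
        using p by simp
    qed (intro tendsto_intros)+
    then show "((\<lambda>\<eta>. ennreal ((M + \<eta> * (L + 1)) powr p)) \<longlongrightarrow> ennreal (M powr p)) (at_right 0)"
      by (intro tendsto_ennrealI) simp
    have "eventually (\<lambda>\<eta>::real. 0 < \<eta>) (at_right 0)" by (rule eventually_at_right_less)
    then show "\<forall>\<^sub>F \<eta> in at_right 0. (\<integral>\<^sup>+x. ennreal (enn2real (\<integral>\<^sup>+t. ennreal (F x t * \<kappa> t) \<partial>M2) powr p) \<partial>M1)
        \<le> ennreal ((M + \<eta> * (L + 1)) powr p)"
      by eventually_elim (rule perturbed(2))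
  qed simp
qed

end

section \<open>The spaces and their norms\<close>

lemma powr_abs_diff_le:
  fixes a b p :: real
  assumes "1 \<le> p"
  shows "\<bar>a - b\<bar> powr p \<le> 2 powr p * (\<bar>a\<bar> powr p + \<bar>b\<bar> powr p)"
proof -
  define m where "m = max \<bar>a\<bar> \<bar>b\<bar>"
  have "\<bar>a - b\<bar> powr p \<le> (2 * m) powr p"
    using assms by (intro powr_mono2) (auto simp: m_def)
  also have "\<dots> = 2 powr p * m powr p" by (simp add: powr_mult m_def)
  also have "m powr p \<le> \<bar>a\<bar> powr p + \<bar>b\<bar> powr p" by (auto simp: m_def max_def)
  finally show ?thesis by simp
qed

lemma AE_lebesgue_on_iff:
  "(AE x in lebesgue_on {-pi..pi}. P x) \<longleftrightarrow> (AE x in lebesgue. x \<in> {-pi..pi} \<longrightarrow> P x)"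
  by (subst AE_restrict_space_iff) auto

lemma le_real_of_ereal: "e < \<infinity> \<Longrightarrow> e \<le> ereal (real_of_ereal e)"
  by (cases e) auto

lemma Linf_AE_norm_le:
  assumes "f \<in> space_of Linf"
  shows "AE x in lebesgue. x \<in> {-pi..pi} \<longrightarrow> \<bar>f x\<bar> \<le> norm_of Linf f"
proof -
  have "AE x in lebesgue_on {-pi..pi}. \<bar>f x\<bar> \<le> norm_of Linf f"
    using esssup_AE[of "\<lambda>t. ereal \<bar>f t\<bar>" "lebesgue_on {-pi..pi}"]
  proof eventually_elim
    case (elim x)
    also have "esssup (lebesgue_on {-pi..pi}) (\<lambda>t. ereal \<bar>f t\<bar>) \<le> ereal (norm_of Linf f)"
      using assms by (simp add: le_real_of_ereal)
    finally show ?case by simp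
  qed
  then show ?thesis by (simp add: AE_lebesgue_on_iff)
qed

lemma Linf_norm_leI:
  assumes f: "periodic_2pi f" "f \<in> borel_measurable lebesgue" and c: "0 \<le> c"
    and AE: "AE x in lebesgue. x \<in> {-pi..pi} \<longrightarrow> \<bar>f x\<bar> \<le> c"
  shows "f \<in> space_of Linf" "norm_of Linf f \<le> c"
proof -
  have [measurable]: "f \<in> borel_measurable (lebesgue_on {-pi..pi})"
    using f(2) by (rule measurable_restrict_space1)
  have "esssup (lebesgue_on {-pi..pi}) (\<lambda>t. ereal \<bar>f t\<bar>) \<le> ereal c"
    using AE by (intro esssup_I) (auto simp: AE_lebesgue_on_iff)
  then show "f \<in> space_of Linf" "norm_of Linf f \<le> c"
    using f c by (cases "esssup (lebesgue_on {-pi..pi}) (\<lambda>t. ereal \<bar>f t\<bar>)"; auto)+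
qed

lemma Cont_bounded:
  assumes "f \<in> space_of Cont"
  obtains b where "\<And>x. \<bar>f x\<bar> \<le> b"
proof -
  have cont: "continuous_on {-pi..pi} f" and per: "\<And>x. f (x + 2 * pi) = f x"
    using assms by (auto intro: continuous_on_subset simp: periodic_2pi_def)
  from compact_imp_bounded[OF compact_continuous_image[OF cont compact_Icc]]
  obtain b where b: "\<And>x. x \<in> {-pi..pi} \<Longrightarrow> \<bar>f x\<bar> \<le> b" unfolding bounded_iff by fastforce
  have "\<bar>f x\<bar> \<le> b" for x
  proof -
    define m where "m = \<lfloor>(x + pi) / (2 * pi)\<rfloor>"
    have "real_of_int m \<le> (x + pi) / (2 * pi)" "(x + pi) / (2 * pi) < real_of_int m + 1"
      unfolding m_def by linarith+
    then have "real_of_int m * (2 * pi) \<le> x + pi" "x + pi < (real_of_int m + 1) * (2 * pi)"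
      by (auto simp: field_simps)
    then have "x - 2 * pi * real_of_int m \<in> {-pi..pi}" by (auto simp: algebra_simps)
    then show ?thesis using b[of "x + 2 * pi * real_of_int (- m)"] periodic_shift_int[of f x "- m", OF per] by simp
  qed
  then show ?thesis by (rule that)
qed

lemma Cont_abs_le_norm:
  assumes "f \<in> space_of Cont"
  shows "\<bar>f x\<bar> \<le> norm_of Cont f"
proof -
  obtain b where "\<And>x. \<bar>f x\<bar> \<le> b" using Cont_bounded[OF assms] by blast
  then have "bdd_above (range (\<lambda>t. \<bar>f t\<bar>))" unfolding bdd_above_def by blast
  then show ?thesis by (auto intro: cSUP_upper)
qed

lemma norm_of_nonneg:
  assumes "f \<in> space_of X"
  shows "0 \<le> norm_of X f"
proof (cases X)
  case Linf
  have [measurable]: "f \<in> borel_measurable (lebesgue_on {-pi..pi})"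
    using assms Linf by (auto intro: measurable_restrict_space1)
  have "esssup (lebesgue_on {-pi..pi}) (\<lambda>t. 0 :: ereal) \<le> esssup (lebesgue_on {-pi..pi}) (\<lambda>t. ereal \<bar>f t\<bar>)"
    by (rule esssup_mono) auto
  moreover have "esssup (lebesgue_on {-pi..pi}) (\<lambda>t. 0 :: ereal) = 0"
    by (rule esssup_const) (simp add: emeasure_restrict_space)
  ultimately show ?thesis using Linf by (simp add: real_of_ereal_pos)
next
  case Cont
  then show ?thesis using Cont_abs_le_norm[of f 0] assms by simp
qed simp

lemma space_of_imp_periodic_integrable:
  assumes X: "\<forall>p. X = Lp p \<longrightarrow> 1 \<le> p" and f: "f \<in> space_of X"
  shows "periodic_integrable f"
proof
  show "f (x + 2 * pi) = f x" for x using f by (cases X) (auto simp: periodic_2pi_def)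
  show meas: "f \<in> borel_measurable lebesgue"
    using f by (cases X) (auto intro: borel_measurable_lebesgueI borel_measurable_continuous_onI)
  have const: "set_integrable lebesgue {-pi..pi} (\<lambda>t. c :: real)" for c
    by (simp add: set_integrable_def)
  have bounded: "set_integrable lebesgue {-pi..pi} f"
    if "set_integrable lebesgue {-pi..pi} g" "AE t in lebesgue. t \<in> {-pi..pi} \<longrightarrow> \<bar>f t\<bar> \<le> g t" for g :: "real \<Rightarrow> real"
    unfolding set_integrable_def
  proof (rule Bochner_Integration.integrable_bound)
    show "integrable lebesgue (\<lambda>t. indicator {-pi..pi} t *\<^sub>R g t)"
      using that(1) by (simp add: set_integrable_def)
    show "(\<lambda>t. indicator {-pi..pi} t *\<^sub>R f t) \<in> borel_measurable lebesgue"
      using meas by measurable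
    show "AE t in lebesgue. norm (indicator {-pi..pi} t *\<^sub>R f t) \<le> norm (indicator {-pi..pi} t *\<^sub>R g t)"
      using that(2) by eventually_elim (auto split: split_indicator)
  qed
  show "set_integrable lebesgue {-pi..pi} f"
  proof (cases X)
    case (Lp p)
    show ?thesis
    proof (rule bounded)
      show "set_integrable lebesgue {-pi..pi} (\<lambda>t. 1 + \<bar>f t\<bar> powr p)"
        using f Lp const[of 1] by (intro set_integral_add) auto
      have "\<bar>f t\<bar> \<le> 1 + \<bar>f t\<bar> powr p" for t
      proof (cases "\<bar>f t\<bar> \<le> 1")
        case False
        then have "\<bar>f t\<bar> powr 1 \<le> \<bar>f t\<bar> powr p" using X Lp by (intro powr_mono) auto
        then show ?thesis using False by simp
      qed (simp add: add_increasing2)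
      then show "AE t in lebesgue. t \<in> {-pi..pi} \<longrightarrow> \<bar>f t\<bar> \<le> 1 + \<bar>f t\<bar> powr p" by simp
    qed
  next
    case Linf
    show ?thesis
      using Linf_AE_norm_le[of f] f Linf by (intro bounded[OF const]) auto
  next
    case Cont
    show ?thesis
      using Cont_abs_le_norm[of f] f Cont by (intro bounded[OF const, of "norm_of Cont f"]) auto
  qed
qed

text \<open>
  The uniform bound on the norms guarantees that the supremum which defines the modulus of continuity
  is an upper bound of them, and not an arbitrary real number.
\<close>

lemma psi_in_space_of:
  assumes X: "\<forall>p. X = Lp p \<longrightarrow> 1 \<le> p" and f: "f \<in> space_of X"
  shows "\<exists>b. \<forall>t. (\<lambda>x. psi f x t) \<in> space_of X \<and> norm_of X (\<lambda>x. psi f x t) \<le> b"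
proof -
  interpret periodic_integrable f using X f by (rule space_of_imp_periodic_integrable)
  have per: "periodic_2pi (\<lambda>x. psi f x t)" for t
    unfolding periodic_2pi_def psi_def
  proof
    fix x
    show "f (x + 2 * pi + t) - f (x + 2 * pi - t) = f (x + t) - f (x - t)"
      using periodic[of "x + t"] periodic[of "x - t"] by (simp add: algebra_simps)
  qed
  show ?thesis
  proof (cases X)
    case (Lp p)
    then have p: "1 \<le> p" using X by simp
    have fp: "set_integrable lebesgue {-pi..pi} (\<lambda>x. \<bar>f x\<bar> powr p)" using f Lp by simp
    have shift: "set_integrable lebesgue {-pi..pi} (\<lambda>x. \<bar>f (t + x)\<bar> powr p)"
      "(LINT x:{-pi..pi}|lebesgue. \<bar>f (t + x)\<bar> powr p) = (LINT x:{-pi..pi}|lebesgue. \<bar>f x\<bar> powr p)" for t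
      using integral_periodic_shift[of "\<lambda>x. \<bar>f x\<bar> powr p" t] fp periodic by auto
    have dom: "set_integrable lebesgue {-pi..pi} (\<lambda>x. 2 powr p * (\<bar>f (t + x)\<bar> powr p + \<bar>f (- t + x)\<bar> powr p))" for t
      by (intro set_integrable_mult_right set_integral_add shift)
    have le: "\<bar>psi f x t\<bar> powr p \<le> 2 powr p * (\<bar>f (t + x)\<bar> powr p + \<bar>f (- t + x)\<bar> powr p)" for x t
      using powr_abs_diff_le[OF p, of "f (x + t)" "f (x - t)"] by (simp add: psi_def add.commute)
    have int: "set_integrable lebesgue {-pi..pi} (\<lambda>x. \<bar>psi f x t\<bar> powr p)" for t
      using dom[of t] unfolding set_integrable_def
    proof (rule Bochner_Integration.integrable_bound)
      show "(\<lambda>x. indicator {-pi..pi} x *\<^sub>R \<bar>psi f x t\<bar> powr p) \<in> borel_measurable lebesgue" by measurable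
    qed (use le in \<open>auto split: split_indicator simp: abs_mult intro!: AE_I2\<close>)
    show ?thesis
    proof (intro exI[of _ "(2 powr p * (2 * (LINT x:{-pi..pi}|lebesgue. \<bar>f x\<bar> powr p))) powr (1 / p)"] allI conjI)
      show "(\<lambda>x. psi f x t) \<in> space_of X" for t using Lp int per by simp
      show "norm_of X (\<lambda>x. psi f x t) \<le> (2 powr p * (2 * (LINT x:{-pi..pi}|lebesgue. \<bar>f x\<bar> powr p))) powr (1 / p)" for t
      proof -
        have "(LINT x:{-pi..pi}|lebesgue. \<bar>psi f x t\<bar> powr p)
            \<le> (LINT x:{-pi..pi}|lebesgue. 2 powr p * (\<bar>f (t + x)\<bar> powr p + \<bar>f (- t + x)\<bar> powr p))"
          using int dom le by (rule set_integral_mono)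
        also have "\<dots> = 2 powr p * (2 * (LINT x:{-pi..pi}|lebesgue. \<bar>f x\<bar> powr p))"
          using shift[of t] shift[of "- t"] by (simp add: set_integral_add)
        finally show ?thesis
          using Lp p by (auto intro!: powr_mono2 simp: set_lebesgue_integral_def)
      qed
    qed
  next
    case Linf
    have c: "0 \<le> norm_of Linf f" using norm_of_nonneg[of f Linf] f Linf by simp
    have "AE x in lebesgue. \<bar>f x\<bar> \<le> norm_of Linf f"
      by (rule AE_of_periodic) (use periodic Linf_AE_norm_le f Linf in \<open>auto simp del: norm_of.simps\<close>)
    then have AE: "AE x in lebesgue. \<bar>f (t + 1 * x)\<bar> \<le> norm_of Linf f" for t
      by (rule AE_lebesgue_affine) simp
    have AE2: "AE x in lebesgue. x \<in> {-pi..pi} \<longrightarrow> \<bar>psi f x t\<bar> \<le> 2 * norm_of Linf f" for t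
      using AE[of t] AE[of "- t"]
      by eventually_elim (auto simp: psi_def add.commute simp del: norm_of.simps)
    have "0 \<le> 2 * norm_of Linf f" using c by (rule mult_nonneg_nonneg[rotated]) simp
    then have "(\<lambda>x. psi f x t) \<in> space_of Linf" "norm_of Linf (\<lambda>x. psi f x t) \<le> 2 * norm_of Linf f" for t
      using Linf_norm_leI[OF per measurable_psi(2) _ AE2] by blast+
    then show ?thesis unfolding Linf by blast
  next
    case Cont
    then have f': "f \<in> space_of Cont" using f by simp
    show ?thesis
    proof (intro exI[of _ "2 * norm_of Cont f"] allI conjI)
      have "continuous_on UNIV f" using f' by simp
      moreover have "continuous_on UNIV (\<lambda>x::real. x + s)" for s by (intro continuous_intros)
      ultimately have shift: "continuous_on UNIV (\<lambda>x. f (x + s))" for s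
        by (rule continuous_on_compose2) simp
      have "continuous_on UNIV (\<lambda>x. psi f x t)" for t
        using continuous_on_diff[OF shift[of t] shift[of "- t"]] by (simp add: psi_def)
      with per show "(\<lambda>x. psi f x t) \<in> space_of X" for t unfolding Cont by simp
      have le: "\<bar>psi f x t\<bar> \<le> 2 * norm_of Cont f" for x t
        using Cont_abs_le_norm[OF f', of "x + t"] Cont_abs_le_norm[OF f', of "x - t"]
        unfolding psi_def by linarith
      have "(SUP x. \<bar>psi f x t\<bar>) \<le> 2 * norm_of Cont f" for t
        by (rule cSUP_least) (simp_all only: le UNIV_not_empty not_False_eq_True)
      then show "norm_of X (\<lambda>x. psi f x t) \<le> 2 * norm_of Cont f" for t
        unfolding Cont norm_of.simps(3)[of "\<lambda>x. psi f x t"] .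
    qed
  qed
qed

context periodic_integrable
begin

lemma psi_periodic: "psi f (x + 2 * pi) = psi f x"
proof
  fix t
  show "psi f (x + 2 * pi) t = psi f x t"
    using periodic[of "x + t"] periodic[of "x - t"] by (simp add: psi_def algebra_simps)
qed

text \<open>
  For Lebesgue measurable \<open>f\<close> the function \<open>(x, t) \<mapsto> f(x + t)\<close> need not be measurable with respect to
  the product of the two sigma-algebras, as Tonelli's theorem requires. It is so after \<open>f\<close> has been
  modified on a null set to become Borel measurable, and this changes \<open>\<psi>\<^sub>x(t)\<close> only for almost
  every \<open>t\<close> with \<open>x\<close> fixed and only for almost every \<open>x\<close> with \<open>t\<close> fixed.
\<close>

lemma borel_psi_exists:
  "\<exists>\<phi> :: real \<Rightarrow> real \<Rightarrow> real. case_prod \<phi> \<in> borel_measurable (lborel \<Otimes>\<^sub>M lborel) \<and>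
    (\<forall>x. AE t in lborel. psi f x t = \<phi> x t) \<and> (\<forall>t. AE x in lborel. psi f x t = \<phi> x t)"
proof -
  obtain g where [measurable]: "g \<in> borel_measurable lborel" and "AE x in lborel. f x = g x"
    using completion_ex_borel_measurable_real[OF measurable] by blast
  then have AE: "AE x in lebesgue. f x = g x" by (intro AE_completion)
  have neg_one_ne: "- 1 \<noteq> (0::real)" by simp
  have aff: "AE x in lborel. f (t + c * x) = g (t + c * x)" if "c \<noteq> 0" for t c
    using AE_lebesgue_affine[OF AE that] by (simp add: AE_completion_iff)
  show ?thesis
  proof (intro exI[of _ "\<lambda>x t. g (x + t) - g (x - t)"] conjI allI)
    show "(\<lambda>(x, t). g (x + t) - g (x - t)) \<in> borel_measurable (lborel \<Otimes>\<^sub>M lborel)" by measurable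
    show "AE t in lborel. psi f x t = g (x + t) - g (x - t)" for x
      using aff[of 1 x, OF one_neq_zero] aff[of "-1" x, OF neg_one_ne] by eventually_elim (simp add: psi_def)
    show "AE x in lborel. psi f x t = g (x + t) - g (x - t)" for t
      using aff[of 1 t, OF one_neq_zero] aff[of 1 "- t", OF one_neq_zero] by eventually_elim (simp add: psi_def add.commute)
  qed
qed

lemma
  assumes \<kappa> [measurable]: "\<kappa> \<in> borel_measurable borel"
    and M: "0 \<le> M" and le: "(\<integral>\<^sup>+t\<in>{0<..pi}. ennreal \<bar>psi f x t * \<kappa> t\<bar> \<partial>lborel) \<le> ennreal M"
  shows set_integrable_psi_mult: "set_integrable lebesgue {0<..pi} (\<lambda>t. psi f x t * \<kappa> t)"
    and abs_integral_psi_mult_le: "\<bar>LINT t:{0<..pi}|lebesgue. psi f x t * \<kappa> t\<bar> \<le> M"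
proof -
  note [measurable] = borel_measurable_lebesgueI[OF \<kappa>]
  have eq: "(\<integral>\<^sup>+t. ennreal (norm (indicator {0<..pi} t *\<^sub>R (psi f x t * \<kappa> t))) \<partial>lebesgue)
      = (\<integral>\<^sup>+t\<in>{0<..pi}. ennreal \<bar>psi f x t * \<kappa> t\<bar> \<partial>lborel)"
    unfolding nn_integral_completion by (intro nn_integral_cong) (auto split: split_indicator)
  show int: "set_integrable lebesgue {0<..pi} (\<lambda>t. psi f x t * \<kappa> t)"
    unfolding set_integrable_def integrable_iff_bounded
  proof
    show "(\<lambda>t. indicator {0<..pi} t *\<^sub>R (psi f x t * \<kappa> t)) \<in> borel_measurable lebesgue" by measurable
    show "(\<integral>\<^sup>+t. ennreal (norm (indicator {0<..pi} t *\<^sub>R (psi f x t * \<kappa> t))) \<partial>lebesgue) < \<infinity>"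
      using order.strict_trans1[OF le ennreal_less_top] unfolding eq infinity_ennreal_def .
  qed
  have "ennreal (norm (LINT t:{0<..pi}|lebesgue. psi f x t * \<kappa> t)) \<le> ennreal M"
    using integral_norm_bound_ennreal[OF int[unfolded set_integrable_def]] le
    unfolding set_lebesgue_integral_def eq by (rule order_trans)
  then show "\<bar>LINT t:{0<..pi}|lebesgue. psi f x t * \<kappa> t\<bar> \<le> M"
    using M by simp
qed

end

section \<open>Integral transforms of the differences \<open>\<psi>\<^sub>x\<close>\<close>

context periodic_integrable
begin

lemma measurable_integral_psi:
  assumes \<kappa> [measurable]: "\<kappa> \<in> borel_measurable borel"
  shows "(\<lambda>x. LINT t:{0<..pi}|lebesgue. psi f x t * \<kappa> t) \<in> borel_measurable lebesgue"
proof -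
  obtain \<phi> where \<phi> [measurable]: "case_prod \<phi> \<in> borel_measurable (lborel \<Otimes>\<^sub>M lborel)"
    and AE_t: "\<forall>x. AE t in lborel. psi f x t = \<phi> x t"
    using borel_psi_exists by (elim exE conjE)
  note [measurable] = borel_measurable_lebesgueI[OF \<kappa>]
  have [measurable]: "\<phi> x \<in> borel_measurable borel" for x
    using measurable_compose[OF measurable_Pair1'[of x lborel lborel] \<phi>] by simp
  have [measurable]: "\<phi> x \<in> borel_measurable lebesgue" for x
    by (rule borel_measurable_lebesgueI) measurable
  have eq: "(LINT t:{0<..pi}|lebesgue. psi f x t * \<kappa> t)
      = (\<integral>t. indicator {0<..pi} t *\<^sub>R (\<phi> x t * \<kappa> t) \<partial>lborel)" for x
  proof -
    have "(LINT t:{0<..pi}|lebesgue. psi f x t * \<kappa> t) = (LINT t:{0<..pi}|lebesgue. \<phi> x t * \<kappa> t)"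
      unfolding set_lebesgue_integral_def
      by (rule integral_cong_AE, measurable, measurable) (use AE_completion[OF spec[OF AE_t, of x]] in auto)
    also have "\<dots> = (\<integral>t. indicator {0<..pi} t *\<^sub>R (\<phi> x t * \<kappa> t) \<partial>lborel)"
      unfolding set_lebesgue_integral_def by (rule integral_completion) simp
    finally show ?thesis .
  qed
  have "(\<lambda>x. \<integral>t. indicator {0<..pi} t *\<^sub>R (\<phi> x t * \<kappa> t) \<partial>lborel) \<in> borel_measurable lborel"
    by measurable
  then show ?thesis unfolding eq by (intro borel_measurable_lebesgueI) simp
qed

lemma AE_set_integrable_psi_mult:
  assumes \<kappa>: "\<kappa> \<in> borel_measurable borel"
    and AE: "AE x in lebesgue. x \<in> {-pi..pi} \<longrightarrow>
      (\<integral>\<^sup>+t\<in>{0<..pi}. ennreal \<bar>psi f x t * \<kappa> t\<bar> \<partial>lborel) < \<infinity>"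
  shows "AE x in lebesgue. set_integrable lebesgue {0<..pi} (\<lambda>t. psi f x t * \<kappa> t)"
proof (rule AE_of_periodic)
  show "AE x in lebesgue. x \<in> {-pi..pi} \<longrightarrow> set_integrable lebesgue {0<..pi} (\<lambda>t. psi f x t * \<kappa> t)"
    using AE
  proof eventually_elim
    case (elim x)
    then show ?case
      using set_integrable_psi_mult[OF \<kappa>, of "enn2real (\<integral>\<^sup>+t\<in>{0<..pi}. ennreal \<bar>psi f x t * \<kappa> t\<bar> \<partial>lborel)" x]
      by (auto simp: less_top[symmetric])
  qed
qed (simp add: psi_periodic)

context
  fixes w \<kappa> :: "real \<Rightarrow> real" and M :: real
  assumes w [measurable]: "w \<in> borel_measurable borel" and w_nonneg: "\<And>t. 0 \<le> w t"
    and \<kappa> [measurable]: "\<kappa> \<in> borel_measurable borel"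
    and M: "0 \<le> M" and weight: "(\<integral>\<^sup>+t\<in>{0<..pi}. ennreal (w t * \<bar>\<kappa> t\<bar>) \<partial>lborel) \<le> ennreal M"
begin

text \<open>
  Minkowski's integral inequality for the Borel version of \<open>|\<psi>\<^sub>x(t)|\<close>, cut off outside
  \<open>[-\<pi>, \<pi>] \<times> (0, \<pi>]\<close>. The finiteness of the inner integral gives integrability for almost every \<open>x\<close>.
\<close>

lemma Lp_psi_transform:
  assumes p: "1 \<le> p" and psi_space: "\<And>t. (\<lambda>x. psi f x t) \<in> space_of (Lp p)"
    and psi_le: "\<And>t. 0 < t \<Longrightarrow> t \<le> pi \<Longrightarrow> norm_of (Lp p) (\<lambda>x. psi f x t) \<le> w t"
  shows "AE x in lebesgue. set_integrable lebesgue {0<..pi} (\<lambda>t. psi f x t * \<kappa> t)"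
    and "\<lbrakk>periodic_2pi F; AE x in lebesgue. F x = (LINT t:{0<..pi}|lebesgue. psi f x t * \<kappa> t)\<rbrakk>
      \<Longrightarrow> F \<in> space_of (Lp p) \<and> norm_of (Lp p) F \<le> M"
proof -
  obtain \<phi> where \<phi> [measurable]: "case_prod \<phi> \<in> borel_measurable (lborel \<Otimes>\<^sub>M lborel)"
    and AE_t: "\<forall>x. AE t in lborel. psi f x t = \<phi> x t" and AE_x: "\<forall>t. AE x in lborel. psi f x t = \<phi> x t"
    using borel_psi_exists by (elim exE conjE)
  define G where "G x t = (indicator {-pi..pi} x * (indicator {0<..pi} t * \<bar>\<phi> x t\<bar>) :: real)" for x t
  define \<kappa>' where "\<kappa>' t = (indicator {0<..pi} t * \<bar>\<kappa> t\<bar> :: real)" for t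
  define Y where "Y x = (\<integral>\<^sup>+t\<in>{0<..pi}. ennreal \<bar>psi f x t * \<kappa> t\<bar> \<partial>lborel)" for x
  have G [measurable]: "case_prod G \<in> borel_measurable (lborel \<Otimes>\<^sub>M lborel)"
    unfolding G_def by measurable
  have "\<kappa>' \<in> borel_measurable borel" unfolding \<kappa>'_def by measurable
  then have \<kappa>' [measurable]: "\<kappa>' \<in> borel_measurable lborel" by simp
  have w' [measurable]: "w \<in> borel_measurable lborel" by simp
  have G_norm: "(\<integral>\<^sup>+x. ennreal (G x t powr p) \<partial>lborel) \<le> ennreal (w t powr p)" for t
  proof (cases "t \<in> {0<..pi}")
    case True
    define I where "I = (LINT x:{-pi..pi}|lebesgue. \<bar>psi f x t\<bar> powr p)"
    have I: "0 \<le> I" unfolding I_def set_lebesgue_integral_def by (intro Bochner_Integration.integral_nonneg) auto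
    have "(\<integral>\<^sup>+x. ennreal (G x t powr p) \<partial>lborel)
        = (\<integral>\<^sup>+x. ennreal (indicator {-pi..pi} x *\<^sub>R \<bar>psi f x t\<bar> powr p) \<partial>lborel)"
      using spec[OF AE_x, of t] True
      by (intro nn_integral_cong_AE) (auto simp: G_def split: split_indicator)
    also have "\<dots> = ennreal I"
      unfolding I_def set_lebesgue_integral_def
      using psi_space[of t] by (subst nn_integral_completion[symmetric], subst nn_integral_eq_integral)
        (auto simp: set_integrable_def)
    also have "I = (I powr (1 / p)) powr p" using I p by (simp add: powr_powr)
    also have "ennreal \<dots> \<le> ennreal (w t powr p)"
      using psi_le[of t] True I p by (intro ennreal_leI powr_mono2) (auto simp: I_def)
    finally show ?thesis .
  next
    case False
    then have "G x t = 0" for x by (simp add: G_def)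
    then show ?thesis by simp
  qed
  have weight': "(\<integral>\<^sup>+t. ennreal (w t * \<kappa>' t) \<partial>lborel) \<le> ennreal M"
  proof -
    have "(\<integral>\<^sup>+t. ennreal (w t * \<kappa>' t) \<partial>lborel) = (\<integral>\<^sup>+t\<in>{0<..pi}. ennreal (w t * \<bar>\<kappa> t\<bar>) \<partial>lborel)"
      by (intro nn_integral_cong) (auto simp: \<kappa>'_def split: split_indicator)
    then show ?thesis using weight by simp
  qed
  have Y_eq: "(\<integral>\<^sup>+t. ennreal (G x t * \<kappa>' t) \<partial>lborel) = Y x" if "x \<in> {-pi..pi}" for x
    unfolding Y_def using spec[OF AE_t, of x] that
    by (intro nn_integral_cong_AE) (auto simp: G_def \<kappa>'_def abs_mult split: split_indicator)
  have nonneg: "0 \<le> G x t" "0 \<le> \<kappa>' t" for x t by (auto simp: G_def \<kappa>'_def)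
  note Mink = lborel_pair.Minkowski_integral_inequality[OF G w' \<kappa>' nonneg(1) w_nonneg nonneg(2) p M G_norm weight']
  have Y_fin: "AE x in lebesgue. x \<in> {-pi..pi} \<longrightarrow> Y x < \<infinity>"
    using AE_completion[OF Mink(1)] by eventually_elim (auto simp: Y_eq)
  then show "AE x in lebesgue. set_integrable lebesgue {0<..pi} (\<lambda>t. psi f x t * \<kappa> t)"
    unfolding Y_def by (intro AE_set_integrable_psi_mult \<kappa>)
  assume F: "periodic_2pi F" "AE x in lebesgue. F x = (LINT t:{0<..pi}|lebesgue. psi f x t * \<kappa> t)"
  have [measurable]: "F \<in> borel_measurable lebesgue"
    using measurable_integral_psi[OF \<kappa>]
    by (rule borel_measurable_AE) (use F(2) in eventually_elim, simp)
  have "(\<integral>\<^sup>+x. ennreal (indicator {-pi..pi} x *\<^sub>R \<bar>F x\<bar> powr p) \<partial>lebesgue)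
      \<le> (\<integral>\<^sup>+x. ennreal (enn2real (\<integral>\<^sup>+t. ennreal (G x t * \<kappa>' t) \<partial>lborel) powr p) \<partial>lebesgue)"
  proof (rule nn_integral_mono_AE)
    show "AE x in lebesgue. ennreal (indicator {-pi..pi} x *\<^sub>R \<bar>F x\<bar> powr p)
        \<le> ennreal (enn2real (\<integral>\<^sup>+t. ennreal (G x t * \<kappa>' t) \<partial>lborel) powr p)"
      using F(2) Y_fin
    proof eventually_elim
      case (elim x)
      show ?case
      proof (cases "x \<in> {-pi..pi}")
        case True
        then have "\<bar>F x\<bar> \<le> enn2real (Y x)"
          using elim abs_integral_psi_mult_le[OF \<kappa>, of "enn2real (Y x)" x]
          by (simp add: Y_def[symmetric] less_top)
        then show ?thesis using True p by (auto simp: Y_eq intro!: ennreal_leI powr_mono2)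
      qed simp
    qed
  qed
  also have "\<dots> \<le> ennreal (M powr p)" using Mink(2) by (simp add: nn_integral_completion)
  finally have bound: "(\<integral>\<^sup>+x. ennreal (indicator {-pi..pi} x *\<^sub>R \<bar>F x\<bar> powr p) \<partial>lebesgue) \<le> ennreal (M powr p)" .
  have int: "set_integrable lebesgue {-pi..pi} (\<lambda>x. \<bar>F x\<bar> powr p)"
    unfolding set_integrable_def
  proof (rule integrableI_nonneg)
    show "(\<lambda>x. indicator {-pi..pi} x *\<^sub>R \<bar>F x\<bar> powr p) \<in> borel_measurable lebesgue" by measurable
    show "(\<integral>\<^sup>+x. ennreal (indicator {-pi..pi} x *\<^sub>R \<bar>F x\<bar> powr p) \<partial>lebesgue) < \<infinity>"
      using bound by (rule order.strict_trans1) simp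
  qed simp
  have "(LINT x:{-pi..pi}|lebesgue. \<bar>F x\<bar> powr p) \<le> M powr p"
    using bound int unfolding set_lebesgue_integral_def set_integrable_def
    by (subst (asm) nn_integral_eq_integral) (auto simp: ennreal_le_iff)
  then have "norm_of (Lp p) F \<le> (M powr p) powr (1 / p)"
    using p by (auto intro!: powr_mono2 Bochner_Integration.integral_nonneg simp: set_lebesgue_integral_def)
  then show "F \<in> space_of (Lp p) \<and> norm_of (Lp p) F \<le> M"
    using F int p M by (simp add: powr_powr)
qed

text \<open>
  For every \<open>t\<close> the bound \<open>|\<psi>\<^sub>x(t)| \<le> w(t)\<close> holds for almost every \<open>x\<close>; Fubini's theorem exchanges the
  two quantifiers, after which the integral can be estimated pointwise.
\<close>

lemma Linf_psi_transform:
  assumes psi_space: "\<And>t. (\<lambda>x. psi f x t) \<in> space_of Linf"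
    and psi_le: "\<And>t. 0 < t \<Longrightarrow> t \<le> pi \<Longrightarrow> norm_of Linf (\<lambda>x. psi f x t) \<le> w t"
  shows "AE x in lebesgue. set_integrable lebesgue {0<..pi} (\<lambda>t. psi f x t * \<kappa> t)"
    and "\<lbrakk>periodic_2pi F; AE x in lebesgue. F x = (LINT t:{0<..pi}|lebesgue. psi f x t * \<kappa> t)\<rbrakk>
      \<Longrightarrow> F \<in> space_of Linf \<and> norm_of Linf F \<le> M"
proof -
  obtain \<phi> where \<phi> [measurable]: "case_prod \<phi> \<in> borel_measurable (lborel \<Otimes>\<^sub>M lborel)"
    and AE_t: "\<forall>x. AE t in lborel. psi f x t = \<phi> x t" and AE_x: "\<forall>t. AE x in lborel. psi f x t = \<phi> x t"
    using borel_psi_exists by (elim exE conjE)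
  have "AE t in lborel. AE x in lborel. x \<in> {-pi..pi} \<longrightarrow> t \<in> {0<..pi} \<longrightarrow> \<bar>\<phi> x t\<bar> \<le> w t"
  proof (rule AE_I2)
    fix t
    have "AE x in lborel. x \<in> {-pi..pi} \<longrightarrow> \<bar>psi f x t\<bar> \<le> norm_of Linf (\<lambda>x. psi f x t)"
      using Linf_AE_norm_le[OF psi_space[of t]] by (simp only: AE_completion_iff)
    then show "AE x in lborel. x \<in> {-pi..pi} \<longrightarrow> t \<in> {0<..pi} \<longrightarrow> \<bar>\<phi> x t\<bar> \<le> w t"
      using spec[OF AE_x, of t]
    proof eventually_elim
      case (elim x)
      then show ?case using psi_le[of t] by (auto simp del: norm_of.simps)
    qed
  qed
  then have "AE x in lborel. AE t in lborel. x \<in> {-pi..pi} \<longrightarrow> t \<in> {0<..pi} \<longrightarrow> \<bar>\<phi> x t\<bar> \<le> w t"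
  proof (subst lborel_pair.AE_commute)
    have [measurable]: "(\<lambda>z. \<phi> (fst z) (snd z)) \<in> borel_measurable (lborel \<Otimes>\<^sub>M lborel)"
      using \<phi> by (simp only: case_prod_beta')
    have [measurable]: "(\<lambda>z. w (snd z)) \<in> borel_measurable (lborel \<Otimes>\<^sub>M lborel)"
      using measurable_compose[OF measurable_snd, of w lborel borel lborel] w by simp
    show "{z \<in> space (lborel \<Otimes>\<^sub>M lborel). fst z \<in> {-pi..pi} \<longrightarrow> snd z \<in> {0<..pi} \<longrightarrow>
        \<bar>\<phi> (fst z) (snd z)\<bar> \<le> w (snd z)} \<in> sets (lborel \<Otimes>\<^sub>M lborel)"
      unfolding atLeastAtMost_iff greaterThanAtMost_iff by measurable
  qed
  then have Y: "AE x in lebesgue. x \<in> {-pi..pi} \<longrightarrow>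
      (\<integral>\<^sup>+t\<in>{0<..pi}. ennreal \<bar>psi f x t * \<kappa> t\<bar> \<partial>lborel) \<le> ennreal M"
  proof (intro AE_completion, eventually_elim, intro impI)
    fix x :: real
    assume x: "AE t in lborel. x \<in> {-pi..pi} \<longrightarrow> t \<in> {0<..pi} \<longrightarrow> \<bar>\<phi> x t\<bar> \<le> w t" "x \<in> {-pi..pi}"
    have "(\<integral>\<^sup>+t\<in>{0<..pi}. ennreal \<bar>psi f x t * \<kappa> t\<bar> \<partial>lborel)
        \<le> (\<integral>\<^sup>+t\<in>{0<..pi}. ennreal (w t * \<bar>\<kappa> t\<bar>) \<partial>lborel)"
    proof (rule nn_integral_mono_AE)
      show "AE t in lborel. ennreal \<bar>psi f x t * \<kappa> t\<bar> * indicator {0<..pi} t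
          \<le> ennreal (w t * \<bar>\<kappa> t\<bar>) * indicator {0<..pi} t"
        using x(1) spec[OF AE_t, of x]
        by eventually_elim
          (use x(2) in \<open>auto simp: abs_mult split: split_indicator intro!: ennreal_leI mult_right_mono\<close>)
    qed
    also note weight
    finally show "(\<integral>\<^sup>+t\<in>{0<..pi}. ennreal \<bar>psi f x t * \<kappa> t\<bar> \<partial>lborel) \<le> ennreal M" .
  qed
  then have "AE x in lebesgue. x \<in> {-pi..pi} \<longrightarrow>
      (\<integral>\<^sup>+t\<in>{0<..pi}. ennreal \<bar>psi f x t * \<kappa> t\<bar> \<partial>lborel) < \<infinity>"
    by eventually_elim (metis order.strict_trans1 ennreal_less_top infinity_ennreal_def)
  then show "AE x in lebesgue. set_integrable lebesgue {0<..pi} (\<lambda>t. psi f x t * \<kappa> t)"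
    by (intro AE_set_integrable_psi_mult \<kappa>)
  assume F: "periodic_2pi F" "AE x in lebesgue. F x = (LINT t:{0<..pi}|lebesgue. psi f x t * \<kappa> t)"
  have F_meas: "F \<in> borel_measurable lebesgue"
    using measurable_integral_psi[OF \<kappa>]
    by (rule borel_measurable_AE) (use F(2) in eventually_elim, simp)
  have "AE x in lebesgue. x \<in> {-pi..pi} \<longrightarrow> \<bar>F x\<bar> \<le> M"
    using Y F(2) by eventually_elim (use abs_integral_psi_mult_le[OF \<kappa> M] in auto)
  then show "F \<in> space_of Linf \<and> norm_of Linf F \<le> M"
    using Linf_norm_leI[OF F(1) F_meas M] by blast
qed

text \<open>
  Here \<open>|\<psi>\<^sub>x(t)| \<le> w(t)\<close> holds everywhere, and \<open>w |\<kappa>|\<close> is an integrable majorant which makes the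
  integral depend continuously on \<open>x\<close>.
\<close>

lemma Cont_psi_transform:
  assumes f_cont: "continuous_on UNIV f" and psi_space: "\<And>t. (\<lambda>x. psi f x t) \<in> space_of Cont"
    and psi_le: "\<And>t. 0 < t \<Longrightarrow> t \<le> pi \<Longrightarrow> norm_of Cont (\<lambda>x. psi f x t) \<le> w t"
  shows "set_integrable lebesgue {0<..pi} (\<lambda>t. psi f x t * \<kappa> t)"
    and "\<lbrakk>periodic_2pi F; \<And>x. F x = (LINT t:{0<..pi}|lebesgue. psi f x t * \<kappa> t)\<rbrakk>
      \<Longrightarrow> F \<in> space_of Cont \<and> norm_of Cont F \<le> M"
proof -
  have le: "\<bar>psi f x t\<bar> \<le> w t" if "0 < t" "t \<le> pi" for x t
    using Cont_abs_le_norm[OF psi_space[of t], of x] psi_le[OF that] by linarith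
  have Y: "(\<integral>\<^sup>+t\<in>{0<..pi}. ennreal \<bar>psi f x t * \<kappa> t\<bar> \<partial>lborel) \<le> ennreal M" for x
  proof -
    have "(\<integral>\<^sup>+t\<in>{0<..pi}. ennreal \<bar>psi f x t * \<kappa> t\<bar> \<partial>lborel)
        \<le> (\<integral>\<^sup>+t\<in>{0<..pi}. ennreal (w t * \<bar>\<kappa> t\<bar>) \<partial>lborel)"
      using le by (intro nn_integral_mono)
        (auto simp: abs_mult split: split_indicator intro!: ennreal_leI mult_right_mono)
    also note weight
    finally show ?thesis .
  qed
  show "set_integrable lebesgue {0<..pi} (\<lambda>t. psi f x t * \<kappa> t)" for x
    using \<kappa> M Y by (rule set_integrable_psi_mult)
  assume F: "periodic_2pi F" "\<And>x. F x = (LINT t:{0<..pi}|lebesgue. psi f x t * \<kappa> t)"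
  have F_le: "\<bar>F x\<bar> \<le> M" for x
    unfolding F(2) using \<kappa> M Y by (rule abs_integral_psi_mult_le)
  note [measurable] = borel_measurable_lebesgueI[OF \<kappa>] borel_measurable_lebesgueI[OF w]
  have dom: "integrable lebesgue (\<lambda>t. indicator {0<..pi} t *\<^sub>R (w t * \<bar>\<kappa> t\<bar>))"
  proof (rule integrableI_nonneg)
    have "(\<integral>\<^sup>+t. ennreal (indicator {0<..pi} t *\<^sub>R (w t * \<bar>\<kappa> t\<bar>)) \<partial>lebesgue)
        = (\<integral>\<^sup>+t\<in>{0<..pi}. ennreal (w t * \<bar>\<kappa> t\<bar>) \<partial>lborel)"
      unfolding nn_integral_completion by (intro nn_integral_cong) (auto split: split_indicator)
    then show "(\<integral>\<^sup>+t. ennreal (indicator {0<..pi} t *\<^sub>R (w t * \<bar>\<kappa> t\<bar>)) \<partial>lebesgue) < \<infinity>"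
      using order.strict_trans1[OF weight ennreal_less_top] by simp
  qed (use w_nonneg in \<open>auto intro!: AE_I2\<close>)
  have "continuous_on UNIV F"
  proof (rule continuous_on_sequentiallyI)
    fix u :: "nat \<Rightarrow> real" and x
    assume u: "u \<longlonglongrightarrow> x"
    have lim: "(\<lambda>n. indicator {0<..pi} t *\<^sub>R (psi f (u n) t * \<kappa> t))
        \<longlonglongrightarrow> indicator {0<..pi} t *\<^sub>R (psi f x t * \<kappa> t)" for t
    proof -
      have "isCont f y" for y using f_cont by (simp add: continuous_on_eq_continuous_at)
      then have "(\<lambda>n. psi f (u n) t) \<longlonglongrightarrow> psi f x t"
        unfolding psi_def using u by (intro tendsto_diff isCont_tendsto_compose[of _ f]) (auto intro!: tendsto_intros)
      then show ?thesis by (intro tendsto_intros)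
    qed
    show "(\<lambda>n. F (u n)) \<longlonglongrightarrow> F x"
      unfolding F(2) set_lebesgue_integral_def
    proof (rule integral_dominated_convergence[OF _ _ dom])
      show "AE t in lebesgue. norm (indicator {0<..pi} t *\<^sub>R (psi f (u n) t * \<kappa> t))
          \<le> indicator {0<..pi} t *\<^sub>R (w t * \<bar>\<kappa> t\<bar>)" for n
        using le by (auto simp: abs_mult split: split_indicator intro!: AE_I2 mult_right_mono)
    qed (use lim in auto)
  qed
  moreover have "norm_of Cont F \<le> M"
    unfolding norm_of.simps using F_le by (intro cSUP_least) auto
  ultimately show "F \<in> space_of Cont \<and> norm_of Cont F \<le> M" using F(1) by simp
qed

end

end

text \<open>
  The three cases in one form. The second part concerns an arbitrary periodic representative \<open>F\<close>, as
  the deviations agree with the integral only outside a null set.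
\<close>

lemma psi_transform:
  assumes X: "\<forall>p. X = Lp p \<longrightarrow> 1 \<le> p" and f: "f \<in> space_of X"
    and w: "w \<in> borel_measurable borel" "\<And>t. 0 \<le> w t"
    and psi_le: "\<And>t. 0 < t \<Longrightarrow> t \<le> pi \<Longrightarrow> norm_of X (\<lambda>x. psi f x t) \<le> w t"
    and \<kappa>: "\<kappa> \<in> borel_measurable borel"
    and M: "0 \<le> M" "(\<integral>\<^sup>+t\<in>{0<..pi}. ennreal (w t * \<bar>\<kappa> t\<bar>) \<partial>lborel) \<le> ennreal M"
  shows "pointwise_in X (\<lambda>x. set_integrable lebesgue {0<..pi} (\<lambda>t. psi f x t * \<kappa> t))"
    and "\<lbrakk>periodic_2pi F; pointwise_in X (\<lambda>x. F x = (LINT t:{0<..pi}|lebesgue. psi f x t * \<kappa> t))\<rbrakk>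
      \<Longrightarrow> F \<in> space_of X \<and> norm_of X F \<le> M"
proof -
  interpret periodic_integrable f using X f by (rule space_of_imp_periodic_integrable)
  have psi_space: "(\<lambda>x. psi f x t) \<in> space_of X" for t using psi_in_space_of[OF X f] by auto
  have "pointwise_in X (\<lambda>x. set_integrable lebesgue {0<..pi} (\<lambda>t. psi f x t * \<kappa> t)) \<and>
    (periodic_2pi F \<and> pointwise_in X (\<lambda>x. F x = (LINT t:{0<..pi}|lebesgue. psi f x t * \<kappa> t))
      \<longrightarrow> F \<in> space_of X \<and> norm_of X F \<le> M)"
  proof (cases X)
    case (Lp p)
    then have "1 \<le> p" using X by simp
    from Lp_psi_transform[OF w \<kappa> M this psi_space[unfolded Lp] psi_le[unfolded Lp]]
    show ?thesis unfolding Lp pointwise_in_def by auto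
  next
    case Linf
    from Linf_psi_transform[OF w \<kappa> M psi_space[unfolded Linf] psi_le[unfolded Linf]]
    show ?thesis unfolding Linf pointwise_in_def by auto
  next
    case Cont
    have "continuous_on UNIV f" using f Cont by simp
    from Cont_psi_transform[OF w \<kappa> M this psi_space[unfolded Cont] psi_le[unfolded Cont]]
    show ?thesis unfolding Cont pointwise_in_def by auto
  qed
  then show "pointwise_in X (\<lambda>x. set_integrable lebesgue {0<..pi} (\<lambda>t. psi f x t * \<kappa> t))"
    "\<lbrakk>periodic_2pi F; pointwise_in X (\<lambda>x. F x = (LINT t:{0<..pi}|lebesgue. psi f x t * \<kappa> t))\<rbrakk>
      \<Longrightarrow> F \<in> space_of X \<and> norm_of X F \<le> M" by blast+
qed

section \<open>The deviations as integral transforms\<close>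

lemma pointwise_in_mono:
  "pointwise_in X P \<Longrightarrow> (\<And>x. P x \<Longrightarrow> Q x) \<Longrightarrow> pointwise_in X Q"
  unfolding pointwise_in_def by (auto split: if_splits elim!: eventually_mono)

lemma bigo_principalE:
  fixes g h :: "'a \<Rightarrow> real"
  assumes "g \<in> O[principal S](h)"
  obtains c where "0 < c" "\<And>x. x \<in> S \<Longrightarrow> \<bar>g x\<bar> \<le> c * \<bar>h x\<bar>"
proof -
  obtain c where "0 < c" "eventually (\<lambda>x. norm (g x) \<le> c * norm (h x)) (principal S)"
    using assms by (rule landau_o.bigE)
  then show ?thesis by (intro that[of c]) (simp_all add: eventually_principal)
qed

lemma norm_psi_le_modulus:
  assumes X: "\<forall>p. X = Lp p \<longrightarrow> 1 \<le> p" and \<omega>: "modulus_type \<omega>" and f: "f \<in> space_omega X \<omega>"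
  obtains K where "0 \<le> K" "\<And>t. 0 < t \<Longrightarrow> t \<le> pi \<Longrightarrow> norm_of X (\<lambda>x. psi f x t) \<le> K * \<omega> t"
proof -
  have fX: "f \<in> space_of X" and O: "conj_modulus2 X f \<in> O[principal {0..2 * pi}](\<omega>)"
    using f by (auto simp: space_omega_def)
  obtain K where K: "0 < K" "\<And>\<delta>. \<delta> \<in> {0..2 * pi} \<Longrightarrow> \<bar>conj_modulus2 X f \<delta>\<bar> \<le> K * \<bar>\<omega> \<delta>\<bar>"
    using bigo_principalE[OF O] by blast
  obtain b where b: "\<And>t. norm_of X (\<lambda>x. psi f x t) \<le> b" using psi_in_space_of[OF X fX] by auto
  show ?thesis
  proof
    show "0 \<le> K" using K by simp
    fix t :: real assume t: "0 < t" "t \<le> pi"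
    have "norm_of X (\<lambda>x. psi f x t) \<le> (SUP s\<in>{0<..t}. norm_of X (\<lambda>x. psi f x s))"
      using t b by (intro cSUP_upper bdd_aboveI[of _ b]) auto
    also have "\<dots> = conj_modulus2 X f t" using t by (simp add: conj_modulus2_def)
    also have "\<dots> \<le> K * \<bar>\<omega> t\<bar>" using K(2)[of t] t by auto
    also have "\<bar>\<omega> t\<bar> = \<omega> t" using modulus_nonneg[OF \<omega>, of t] t by simp
    finally show "norm_of X (\<lambda>x. psi f x t) \<le> K * \<omega> t" .
  qed
qed

lemma half_cot_le:
  assumes "0 < t" "t \<le> pi"
  shows "\<bar>1 / 2 * cot (t / 2)\<bar> \<le> pi / t"
proof -
  have s: "t / pi \<le> sin (t / 2)" using assms by (intro sin_half_ge) auto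
  have t: "0 < t / pi" using assms by simp
  have "\<bar>1 / 2 * cot (t / 2)\<bar> = \<bar>cos (t / 2)\<bar> / 2 / \<bar>sin (t / 2)\<bar>"
    by (simp add: cot_def abs_mult)
  also have "\<dots> \<le> 1 / (t / pi)"
    using s t abs_cos_le_one[of "t / 2"] by (intro frac_le) linarith+
  finally show ?thesis by simp
qed

lemma singular_kernel_le:
  assumes "0 < t" "t \<le> pi"
  shows "\<bar>1 / pi * (k / (2 * sin (t / 2)))\<bar> \<le> \<bar>k\<bar> / t"
proof -
  have s: "t / pi \<le> sin (t / 2)" using assms by (intro sin_half_ge) auto
  have t: "0 < t / pi" using assms by simp
  have "\<bar>1 / pi * (k / (2 * sin (t / 2)))\<bar> = 1 / pi * (\<bar>k\<bar> / (2 * \<bar>sin (t / 2)\<bar>))"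
    by (simp add: abs_mult)
  also have "\<dots> \<le> 1 / pi * (\<bar>k\<bar> / (t / pi))"
    using s t by (intro mult_left_mono frac_le) auto
  finally show ?thesis by simp
qed

context periodic_integrable
begin

lemma conj_mean_periodic: "conj_mean a n f (x + 2 * pi) = conj_mean a n f x"
  by (simp add: conj_mean_def conj_partial_sum_eq_integral psi_periodic)

lemma conj_trunc_periodic: "conj_trunc f (x + 2 * pi) = conj_trunc f x"
  by (simp add: fun_eq_iff conj_trunc_def psi_periodic)

lemma conj_fun_periodic: "conj_fun f (x + 2 * pi) = conj_fun f x"
  by (simp add: conj_fun_def conj_trunc_periodic)

text \<open>
  The assumption that \<open>\<psi>\<^sub>x(t)/t\<close> is integrable makes the truncated integrals converge absolutely; the
  limit and the mean can then be subtracted under the integral sign, where \<open>cot(t/2)/2\<close> cancels.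
\<close>

lemma conj_fun_deviation:
  assumes a: "\<And>k. 0 \<le> a n k" "a n sums 1"
    and int: "set_integrable lebesgue {0<..pi} (\<lambda>t. psi f x t * (pi / t))"
  shows "summable (\<lambda>k. a n k * conj_partial_sum f k x)"
    and "\<exists>l. (conj_trunc f x \<longlongrightarrow> l) (at_right 0)"
    and "conj_mean a n f x - conj_fun f x
      = (LINT t:{0<..pi}|lebesgue. psi f x t * (1 / pi * (mean_kernel (a n) t / (2 * sin (t / 2)))))"
proof -
  define Q where "Q t = 1 / 2 * cot (t / 2) - mean_kernel (a n) t / (2 * sin (t / 2))" for t
  have B: "(\<Sum>k<N. \<bar>a n k * conj_dirichlet k t\<bar>) \<le> pi / t" if t: "0 < t" "t \<le> pi" for N t
  proof -
    have "(\<Sum>k<N. \<bar>a n k * conj_dirichlet k t\<bar>) \<le> (\<Sum>k<N. a n k * (pi / t))"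
      using a abs_conj_dirichlet_le_inverse[OF t]
      by (intro sum_mono) (simp only: abs_mult abs_of_nonneg mult_left_mono)
    also have "\<dots> = (\<Sum>k<N. a n k) * (pi / t)" by (simp only: sum_distrib_right)
    also have "\<dots> \<le> 1 * (pi / t)"
      using sum_le_suminf[of "a n" "{..<N}"] a t by (intro mult_right_mono) (auto simp: sums_iff)
    finally show ?thesis by simp
  qed
  note sums = conj_mean_sums[OF a B int, folded Q_def]
  show "summable (\<lambda>k. a n k * conj_partial_sum f k x)" using sums(1) by (rule sums_summable)
  have mean: "conj_mean a n f x = - (1 / pi) * (LINT t:{0<..pi}|lebesgue. psi f x t * Q t)"
    unfolding conj_mean_def using sums(1) by (rule sums_unique[symmetric])
  have cot_meas: "(\<lambda>t. 1 / 2 * cot (t / 2) :: real) \<in> borel_measurable lebesgue"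
    by (rule borel_measurable_lebesgueI) (unfold cot_def, measurable)
  have cot_int: "set_integrable lebesgue {0<..pi} (\<lambda>t. psi f x t * (1 / 2 * cot (t / 2)))"
    unfolding set_integrable_def
  proof (rule Bochner_Integration.integrable_bound)
    show "integrable lebesgue (\<lambda>t. indicator {0<..pi} t *\<^sub>R (psi f x t * (pi / t)))"
      using int by (simp add: set_integrable_def)
    show "(\<lambda>t. indicator {0<..pi} t *\<^sub>R (psi f x t * (1 / 2 * cot (t / 2)))) \<in> borel_measurable lebesgue"
      using cot_meas by measurable
    have "\<bar>psi f x t\<bar> * \<bar>1 / 2 * cot (t / 2)\<bar> \<le> \<bar>psi f x t\<bar> * (pi / t)" if "0 < t" "t \<le> pi" for t
      using half_cot_le[OF that] by (intro mult_left_mono) auto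
    then show "AE t in lebesgue. norm (indicator {0<..pi} t *\<^sub>R (psi f x t * (1 / 2 * cot (t / 2))))
        \<le> norm (indicator {0<..pi} t *\<^sub>R (psi f x t * (pi / t)))"
      by (intro AE_I2) (auto simp: abs_mult split: split_indicator)
  qed
  have lim: "(conj_trunc f x \<longlongrightarrow> - (1 / pi) * (LINT t:{0<..pi}|lebesgue. psi f x t * (1 / 2 * cot (t / 2)))) (at_right 0)"
    unfolding conj_trunc_def
    by (intro tendsto_mult_left tendsto_set_lebesgue_integral_at_right cot_int) auto
  then show "\<exists>l. (conj_trunc f x \<longlongrightarrow> l) (at_right 0)" ..
  have "conj_fun f x = - (1 / pi) * (LINT t:{0<..pi}|lebesgue. psi f x t * (1 / 2 * cot (t / 2)))"
    unfolding conj_fun_def using lim by (intro tendsto_Lim) auto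
  then have "conj_mean a n f x - conj_fun f x
      = 1 / pi * ((LINT t:{0<..pi}|lebesgue. psi f x t * (1 / 2 * cot (t / 2)))
          - (LINT t:{0<..pi}|lebesgue. psi f x t * Q t))"
    unfolding mean by (simp add: right_diff_distrib)
  also have "(LINT t:{0<..pi}|lebesgue. psi f x t * (1 / 2 * cot (t / 2)))
          - (LINT t:{0<..pi}|lebesgue. psi f x t * Q t)
      = (LINT t:{0<..pi}|lebesgue. psi f x t * (1 / 2 * cot (t / 2)) - psi f x t * Q t)"
    by (rule set_integral_diff(2)[symmetric, OF cot_int sums(2)])
  also have "1 / pi * \<dots> = (LINT t:{0<..pi}|lebesgue. psi f x t * (1 / pi * (mean_kernel (a n) t / (2 * sin (t / 2)))))"
    unfolding Q_def by (subst set_integral_mult_right[symmetric]) (simp add: algebra_simps)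
  finally show "conj_mean a n f x - conj_fun f x
      = (LINT t:{0<..pi}|lebesgue. psi f x t * (1 / pi * (mean_kernel (a n) t / (2 * sin (t / 2)))))" .
qed

text \<open>
  The factor \<open>cot(t/2)/2\<close> now cancels only on \<open>[\<epsilon>, \<pi>]\<close>. No singularity at \<open>0\<close> arises, because the mean of
  the kernels is bounded by the first moment of the row; hence the identity holds at every \<open>x\<close>.
\<close>

lemma conj_trunc_deviation:
  assumes a: "\<And>k. 0 \<le> a n k" "a n sums 1" and first: "summable (\<lambda>k. (real k + 1) * a n k)"
    and \<epsilon>: "0 < \<epsilon>" "\<epsilon> \<le> pi"
  shows "summable (\<lambda>k. a n k * conj_partial_sum f k x)"
    and "conj_mean a n f x - conj_trunc f x \<epsilon>
      = (LINT t:{0<..pi}|lebesgue. psi f x t * (1 / pi * (indicator {\<epsilon>..pi} t * (1 / 2 * cot (t / 2))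
          - (1 / 2 * cot (t / 2) - mean_kernel (a n) t / (2 * sin (t / 2))))))"
proof -
  define Q where "Q t = 1 / 2 * cot (t / 2) - mean_kernel (a n) t / (2 * sin (t / 2))" for t
  define g where "g t = indicator {\<epsilon>..pi} t * (1 / 2 * cot (t / 2))" for t :: real
  define L where "L = (\<Sum>k. (real k + 1) * a n k)"
  have B: "(\<Sum>k<N. \<bar>a n k * conj_dirichlet k t\<bar>) \<le> L" for N t
  proof -
    have "(\<Sum>k<N. \<bar>a n k * conj_dirichlet k t\<bar>) \<le> (\<Sum>k<N. (real k + 1) * a n k)"
    proof (rule sum_mono)
      fix k
      have "\<bar>conj_dirichlet k t\<bar> \<le> real k + 1" using abs_conj_dirichlet_le[of k t] by simp
      then have "a n k * \<bar>conj_dirichlet k t\<bar> \<le> a n k * (real k + 1)" using a by (intro mult_left_mono) auto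
      then show "\<bar>a n k * conj_dirichlet k t\<bar> \<le> (real k + 1) * a n k" using a by (simp add: abs_mult mult.commute)
    qed
    also have "\<dots> \<le> L" unfolding L_def using a by (intro sum_le_suminf[OF first]) auto
    finally show ?thesis .
  qed
  have L_int: "set_integrable lebesgue {0<..pi} (\<lambda>t. psi f x t * L)"
    using integrable_psi by (rule set_integrable_mult_bounded[where c = "\<bar>L\<bar>"]) auto
  note sums = conj_mean_sums[OF a B L_int, folded Q_def]
  show "summable (\<lambda>k. a n k * conj_partial_sum f k x)" using sums(1) by (rule sums_summable)
  have mean: "conj_mean a n f x = - (1 / pi) * (LINT t:{0<..pi}|lebesgue. psi f x t * Q t)"
    unfolding conj_mean_def using sums(1) by (rule sums_unique[symmetric])
  have g_int: "set_integrable lebesgue {0<..pi} (\<lambda>t. psi f x t * g t)"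
    using integrable_psi
  proof (rule set_integrable_mult_bounded[where c = "pi / \<epsilon>"])
    show "g \<in> borel_measurable lebesgue"
      by (rule borel_measurable_lebesgueI) (unfold g_def cot_def, measurable)
    show "\<bar>g t\<bar> \<le> pi / \<epsilon>" for t
    proof (cases "t \<in> {\<epsilon>..pi}")
      case True
      then have "\<bar>1 / 2 * cot (t / 2)\<bar> \<le> pi / t" using \<epsilon> by (intro half_cot_le) auto
      also have "\<dots> \<le> pi / \<epsilon>" using True \<epsilon> by (intro divide_left_mono) auto
      finally show ?thesis using True by (simp add: g_def)
    qed (use \<epsilon> in \<open>simp add: g_def\<close>)
  qed
  have trunc: "conj_trunc f x \<epsilon> = - (1 / pi) * (LINT t:{0<..pi}|lebesgue. psi f x t * g t)"
    unfolding conj_trunc_def set_lebesgue_integral_def g_def using \<epsilon>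
    by (intro arg_cong[where f = "\<lambda>y. - (1 / pi) * y"] Bochner_Integration.integral_cong)
       (auto split: split_indicator)
  have "conj_mean a n f x - conj_trunc f x \<epsilon>
      = 1 / pi * ((LINT t:{0<..pi}|lebesgue. psi f x t * g t) - (LINT t:{0<..pi}|lebesgue. psi f x t * Q t))"
    unfolding mean trunc by (simp add: right_diff_distrib)
  also have "(LINT t:{0<..pi}|lebesgue. psi f x t * g t) - (LINT t:{0<..pi}|lebesgue. psi f x t * Q t)
      = (LINT t:{0<..pi}|lebesgue. psi f x t * g t - psi f x t * Q t)"
    by (rule set_integral_diff(2)[symmetric, OF g_int sums(2)])
  also have "1 / pi * \<dots> = (LINT t:{0<..pi}|lebesgue. psi f x t * (1 / pi * (g t - Q t)))"
    by (subst set_integral_mult_right[symmetric]) (simp add: algebra_simps)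
  finally show "conj_mean a n f x - conj_trunc f x \<epsilon>
      = (LINT t:{0<..pi}|lebesgue. psi f x t * (1 / pi * (indicator {\<epsilon>..pi} t * (1 / 2 * cot (t / 2))
          - (1 / 2 * cot (t / 2) - mean_kernel (a n) t / (2 * sin (t / 2))))))"
    unfolding g_def Q_def .
qed

end

section \<open>Weight estimates and the theorem\<close>

lemma tail_bound:
  assumes \<omega>: "modulus_type \<omega>" and r: "0 < r"
    and H: "\<forall>u\<in>{0<..pi}. 0 \<le> H u"
    and O: "(\<lambda>u. LINT t:{u..pi}|lebesgue. \<omega> t / t\<^sup>2) \<in> O[principal {0<..pi}](H)"
  obtains C where "0 \<le> C"
    "\<And>b u. (\<And>k. 0 \<le> b k) \<Longrightarrow> b sums 1 \<Longrightarrow> 0 < u \<Longrightarrow> u \<le> pi \<Longrightarrow>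
      (\<integral>\<^sup>+t\<in>{u..pi}. ennreal (\<omega> t / t * \<bar>mean_kernel b t\<bar>) \<partial>lborel)
        \<le> ennreal (C * (\<omega> u + H u * row_variation b r))"
proof -
  obtain c where c: "0 < c"
    "\<And>u. u \<in> {0<..pi} \<Longrightarrow> \<bar>LINT t:{u..pi}|lebesgue. \<omega> t / t\<^sup>2\<bar> \<le> c * \<bar>H u\<bar>"
    using bigo_principalE[OF O] by blast
  define d where "d = 4 + 4 * pi / real r * c"
  have d: "4 \<le> d" "4 * pi / real r * c \<le> d" using c by (auto simp: d_def)
  show ?thesis
  proof
    show "0 \<le> (real r + 1) * d" using d by simp
    fix b :: "nat \<Rightarrow> real" and u :: real
    assume b: "\<And>k. 0 \<le> b k" "b sums 1" and u: "0 < u" "u \<le> pi"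
    define I where "I = (LINT t:{u..pi}|lebesgue. \<omega> t / t\<^sup>2)"
    have V: "0 \<le> row_variation b r" using b by (rule row_variation_nonneg)
    have \<omega>u: "0 \<le> \<omega> u" using u by (intro modulus_nonneg[OF \<omega>]) auto
    have "I \<le> c * H u" using c(2)[of u] H u by (auto simp: I_def)
    then have "4 * pi / real r * row_variation b r * I \<le> 4 * pi / real r * row_variation b r * (c * H u)"
      using V by (intro mult_left_mono) auto
    also have "\<dots> = 4 * pi / real r * c * (H u * row_variation b r)" by (simp add: mult_ac)
    also have "\<dots> \<le> d * (H u * row_variation b r)"
      using d V H u by (intro mult_right_mono) auto
    finally have "4 * \<omega> u + 4 * pi / real r * row_variation b r * I \<le> d * (\<omega> u + H u * row_variation b r)"
      using mult_right_mono[OF d(1) \<omega>u] by (simp add: distrib_left)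
    then have "(real r + 1) * (4 * \<omega> u + 4 * pi / real r * row_variation b r * I)
        \<le> (real r + 1) * (d * (\<omega> u + H u * row_variation b r))"
      by (intro mult_left_mono) auto
    then show "(\<integral>\<^sup>+t\<in>{u..pi}. ennreal (\<omega> t / t * \<bar>mean_kernel b t\<bar>) \<partial>lborel)
        \<le> ennreal ((real r + 1) * d * (\<omega> u + H u * row_variation b r))"
      using order_trans[OF tail_estimate[OF \<omega> b r u] ennreal_leI] by (simp add: I_def mult.assoc)
  qed
qed

lemma nn_integral_set_le_split:
  fixes g h :: "real \<Rightarrow> real"
  assumes h [measurable]: "(\<lambda>t. indicator {0<..u} t * h t) \<in> borel_measurable borel"
    and k: "(\<lambda>t. indicator {u..pi} t * k t) \<in> borel_measurable borel" and u: "0 < u" "u \<le> pi"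
    and near: "\<And>t. 0 < t \<Longrightarrow> t < u \<Longrightarrow> g t \<le> h t"
    and far: "\<And>t. u \<le> t \<Longrightarrow> t \<le> pi \<Longrightarrow> g t \<le> k t"
  shows "(\<integral>\<^sup>+t\<in>{0<..pi}. ennreal (g t) \<partial>lborel)
    \<le> (\<integral>\<^sup>+t\<in>{0<..u}. ennreal (h t) \<partial>lborel) + (\<integral>\<^sup>+t\<in>{u..pi}. ennreal (k t) \<partial>lborel)"
proof -
  have h': "(\<lambda>t. ennreal (h t) * indicator {0<..u} t) \<in> borel_measurable lborel"
  proof -
    have "(\<lambda>t. ennreal (indicator {0<..u} t * h t)) \<in> borel_measurable borel" using h by measurable
    also have "(\<lambda>t. ennreal (indicator {0<..u} t * h t)) = (\<lambda>t. ennreal (h t) * indicator {0<..u} t)"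
      by (auto split: split_indicator)
    finally show ?thesis by simp
  qed
  have k': "(\<lambda>t. ennreal (k t) * indicator {u..pi} t) \<in> borel_measurable lborel"
  proof -
    have "(\<lambda>t. ennreal (indicator {u..pi} t * k t)) \<in> borel_measurable borel" using k by measurable
    also have "(\<lambda>t. ennreal (indicator {u..pi} t * k t)) = (\<lambda>t. ennreal (k t) * indicator {u..pi} t)"
      by (auto split: split_indicator)
    finally show ?thesis by simp
  qed
  have "(\<integral>\<^sup>+t\<in>{0<..pi}. ennreal (g t) \<partial>lborel)
      \<le> (\<integral>\<^sup>+t. ennreal (h t) * indicator {0<..u} t + ennreal (k t) * indicator {u..pi} t \<partial>lborel)"
  proof (rule nn_integral_mono)
    fix t
    show "ennreal (g t) * indicator {0<..pi} t
        \<le> ennreal (h t) * indicator {0<..u} t + ennreal (k t) * indicator {u..pi} t"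
    proof (cases "t \<in> {0<..pi}")
      case True
      show ?thesis
      proof (cases "t < u")
        case True
        then show ?thesis using near[of t] \<open>t \<in> {0<..pi}\<close> by (simp add: ennreal_leI)
      next
        case False
        then show ?thesis
          using far[of t] True by (intro add_increasing) (auto simp: ennreal_leI)
      qed
    qed simp
  qed
  also have "\<dots> = (\<integral>\<^sup>+t\<in>{0<..u}. ennreal (h t) \<partial>lborel) + (\<integral>\<^sup>+t\<in>{u..pi}. ennreal (k t) \<partial>lborel)"
    using h' k' by (rule nn_integral_add)
  finally show ?thesis .
qed

lemma nn_integral_eq_set_integral:
  fixes g :: "real \<Rightarrow> real"
  assumes int: "set_integrable lebesgue A g" and nonneg: "\<And>t. t \<in> A \<Longrightarrow> 0 \<le> g t"
  shows "(\<integral>\<^sup>+t\<in>A. ennreal (g t) \<partial>lborel) = ennreal (LINT t:A|lebesgue. g t)"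
proof -
  have "(\<integral>\<^sup>+t\<in>A. ennreal (g t) \<partial>lborel) = (\<integral>\<^sup>+t. ennreal (indicator A t *\<^sub>R g t) \<partial>lebesgue)"
    unfolding nn_integral_completion by (intro nn_integral_cong) (auto split: split_indicator)
  also have "\<dots> = ennreal (LINT t:A|lebesgue. g t)"
    unfolding set_lebesgue_integral_def
    using int nonneg by (intro nn_integral_eq_integral AE_I2) (auto simp: set_integrable_def split: split_indicator)
  finally show ?thesis .
qed

lemma indicator_modulus_measurable:
  assumes "modulus_type \<omega>" "A \<in> sets borel" "A \<subseteq> {0..2 * pi}" "g \<in> borel_measurable borel"
  shows "(\<lambda>t. indicator A t * (\<omega> t * g t)) \<in> borel_measurable borel"
proof -
  have "(\<lambda>t. indicator A t * (clipped \<omega> t * g t)) \<in> borel_measurable borel"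
    using borel_measurable_clipped[OF assms(1)] assms(2,4) by measurable
  also have "(\<lambda>t. indicator A t * (clipped \<omega> t * g t)) = (\<lambda>t. indicator A t * (\<omega> t * g t))"
    using assms(3) by (fastforce simp: clipped_eq split: split_indicator)
  finally show ?thesis .
qed

text \<open>
  Below \<open>u\<close> nothing better than \<open>|K| \<le> 1\<close> is available, and the assumption on \<open>\<integral>\<^sub>0\<^sup>u \<omega>(t)/t\<close> is just what makes it
  suffice.
\<close>

lemma conj_fun_weight_bound:
  assumes \<omega>: "modulus_type \<omega>" and b: "\<And>k. 0 \<le> b k" "b sums 1" and u: "0 < u" "u \<le> pi"
    and int: "set_integrable lebesgue {0<..u} (\<lambda>t. \<omega> t / t)"
    and near: "(LINT t:{0<..u}|lebesgue. \<omega> t / t) \<le> c * \<omega> u" and c: "0 \<le> c"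
    and R: "\<omega> u \<le> R" and C: "0 \<le> C"
    and far: "(\<integral>\<^sup>+t\<in>{u..pi}. ennreal (\<omega> t / t * \<bar>mean_kernel b t\<bar>) \<partial>lborel) \<le> ennreal (C * R)"
  shows "(\<integral>\<^sup>+t\<in>{0<..pi}. ennreal (\<omega> t * \<bar>1 / pi * (mean_kernel b t / (2 * sin (t / 2)))\<bar>) \<partial>lborel)
    \<le> ennreal ((c + C) * R)"
proof -
  have \<omega>_nonneg: "0 \<le> \<omega> t" if "0 \<le> t" "t \<le> pi" for t using that by (intro modulus_nonneg[OF \<omega>]) auto
  have R0: "0 \<le> R" using R \<omega>_nonneg[of u] u by simp
  have kernel: "\<omega> t * \<bar>1 / pi * (mean_kernel b t / (2 * sin (t / 2)))\<bar> \<le> \<omega> t / t * \<bar>mean_kernel b t\<bar>"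
    if t: "0 < t" "t \<le> pi" for t
    using mult_left_mono[OF singular_kernel_le[OF t, of "mean_kernel b t"] \<omega>_nonneg[of t]] t by simp
  have "(\<integral>\<^sup>+t\<in>{0<..pi}. ennreal (\<omega> t * \<bar>1 / pi * (mean_kernel b t / (2 * sin (t / 2)))\<bar>) \<partial>lborel)
    \<le> (\<integral>\<^sup>+t\<in>{0<..u}. ennreal (\<omega> t / t) \<partial>lborel)
      + (\<integral>\<^sup>+t\<in>{u..pi}. ennreal (\<omega> t / t * \<bar>mean_kernel b t\<bar>) \<partial>lborel)"
  proof (rule nn_integral_set_le_split)
    show "(\<lambda>t. indicator {0<..u} t * (\<omega> t / t)) \<in> borel_measurable borel"
      using indicator_modulus_measurable[OF \<omega>, of "{0<..u}" "\<lambda>t. 1 / t"] u pi_gt_zero by (simp add: subset_eq)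
    show "(\<lambda>t. indicator {u..pi} t * (\<omega> t / t * \<bar>mean_kernel b t\<bar>)) \<in> borel_measurable borel"
      using indicator_modulus_measurable[OF \<omega>, of "{u..pi}" "\<lambda>t. 1 / t * \<bar>mean_kernel b t\<bar>"] u pi_gt_zero
      by (simp add: subset_eq)
    show "\<omega> t * \<bar>1 / pi * (mean_kernel b t / (2 * sin (t / 2)))\<bar> \<le> \<omega> t / t" if "0 < t" "t < u" for t
    proof -
      have "\<omega> t / t * \<bar>mean_kernel b t\<bar> \<le> \<omega> t / t"
        using abs_mean_kernel_le_1[OF b, of t] that u \<omega>_nonneg[of t] by (intro mult_left_le) auto
      then show ?thesis using kernel[of t] that u by linarith
    qed
  qed (use u kernel in auto)
  also have "(\<integral>\<^sup>+t\<in>{0<..u}. ennreal (\<omega> t / t) \<partial>lborel) \<le> ennreal (c * \<omega> u)"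
  proof (subst nn_integral_eq_set_integral[OF int])
    show "0 \<le> \<omega> t / t" if "t \<in> {0<..u}" for t using that \<omega>_nonneg[of t] u by simp
  qed (rule ennreal_leI[OF near])
  also have "ennreal (c * \<omega> u) \<le> ennreal (c * R)" using R c by (intro ennreal_leI mult_left_mono)
  also note far
  also have "ennreal (c * R) + ennreal (C * R) = ennreal ((c + C) * R)"
    using c C R0 by (simp add: distrib_right flip: ennreal_plus)
  finally show ?thesis by (simp add: add_mono)
qed

text \<open>
  With \<open>\<epsilon> = u/r\<close> the kernel is bounded by \<open>c/u\<close> below \<open>\<epsilon>\<close>. Between \<open>\<epsilon>\<close> and \<open>u\<close> it is the singular
  kernel, but there \<open>\<omega>(t)/t \<le> r \<omega>(u)/u\<close>. Both bounds are constants, integrated over a length of at most \<open>u\<close>.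
\<close>

lemma conj_trunc_weight_bound:
  assumes \<omega>: "modulus_type \<omega>" and b: "\<And>k. 0 \<le> b k" "b sums 1" and u: "0 < u" "u \<le> pi" and r: "0 < r"
    and first: "summable (\<lambda>k. (real k + 1) * b k)" "(\<Sum>k. (real k + 1) * b k) \<le> c / u" and c: "0 \<le> c"
    and R: "\<omega> u \<le> R" and C: "0 \<le> C"
    and far: "(\<integral>\<^sup>+t\<in>{u..pi}. ennreal (\<omega> t / t * \<bar>mean_kernel b t\<bar>) \<partial>lborel) \<le> ennreal (C * R)"
  shows "(\<integral>\<^sup>+t\<in>{0<..pi}. ennreal (\<omega> t * \<bar>1 / pi * (indicator {u / real r..pi} t * (1 / 2 * cot (t / 2))
          - (1 / 2 * cot (t / 2) - mean_kernel b t / (2 * sin (t / 2))))\<bar>) \<partial>lborel)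
    \<le> ennreal ((c + real r + C) * R)"
proof -
  define q where "q t = 1 / pi * (indicator {u / real r..pi} t * (1 / 2 * cot (t / 2))
          - (1 / 2 * cot (t / 2) - mean_kernel b t / (2 * sin (t / 2))))" for t
  have \<omega>_nonneg: "0 \<le> \<omega> t" if "0 \<le> t" "t \<le> pi" for t using that by (intro modulus_nonneg[OF \<omega>]) auto
  have \<omega>u: "0 \<le> \<omega> u" using \<omega>_nonneg u by simp
  have R0: "0 \<le> R" using R \<omega>u by simp
  have ur: "u / real r \<le> u" using r u by (simp add: divide_le_eq)
  have kernel: "\<omega> t * \<bar>q t\<bar> \<le> \<omega> t / t * \<bar>mean_kernel b t\<bar>" if t: "0 < t" "t \<le> pi" "u / real r \<le> t" for t
    using mult_left_mono[OF singular_kernel_le[OF t(1,2), of "mean_kernel b t"] \<omega>_nonneg[of t]] t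
    by (simp add: q_def)
  have near: "\<omega> t * \<bar>q t\<bar> \<le> \<omega> u * ((c + real r) / u)" if t: "0 < t" "t < u" for t
  proof (cases "t < u / real r")
    case True
    have "(\<lambda>k. b k * conj_dirichlet k t) sums (1 / 2 * cot (t / 2) - mean_kernel b t / (2 * sin (t / 2)))"
      using t u b by (intro sums_conj_dirichlet) auto
    then have "1 / 2 * cot (t / 2) - mean_kernel b t / (2 * sin (t / 2)) = (\<Sum>k. b k * conj_dirichlet k t)"
      by (rule sums_unique)
    also have "\<bar>\<dots>\<bar> \<le> (\<Sum>k. (real k + 1) * b k)"
    proof (rule abs_suminf_le[OF first(1)])
      fix k
      have "\<bar>conj_dirichlet k t\<bar> \<le> real k + 1" using abs_conj_dirichlet_le[of k t] by simp
      then have "b k * \<bar>conj_dirichlet k t\<bar> \<le> b k * (real k + 1)" using b by (intro mult_left_mono) auto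
      then show "\<bar>b k * conj_dirichlet k t\<bar> \<le> (real k + 1) * b k" using b by (simp add: abs_mult mult.commute)
    qed
    also note first(2)
    finally have *: "\<bar>1 / 2 * cot (t / 2) - mean_kernel b t / (2 * sin (t / 2))\<bar> \<le> c / u" .
    have "\<bar>q t\<bar> = 1 / pi * \<bar>1 / 2 * cot (t / 2) - mean_kernel b t / (2 * sin (t / 2))\<bar>"
      using True by (simp add: q_def abs_mult)
    also have "\<dots> \<le> 1 * (c / u)"
      using * pi_gt3 by (intro mult_mono) auto
    also have "\<dots> \<le> (c + real r) / u" using u by (simp add: divide_right_mono)
    finally show ?thesis
      using t u \<omega>u by (intro mult_mono modulus_mono[OF \<omega>]) auto
  next
    case False
    have "\<omega> t * \<bar>q t\<bar> \<le> \<omega> t / t * \<bar>mean_kernel b t\<bar>" using False t u by (intro kernel) auto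
    also have "\<dots> \<le> \<omega> t / t"
      using abs_mean_kernel_le_1[OF b, of t] t u \<omega>_nonneg[of t] by (intro mult_left_le) auto
    also have "\<dots> \<le> \<omega> u / (u / real r)"
      using False t u r \<omega>u by (intro frac_le modulus_mono[OF \<omega>]) auto
    also have "\<dots> = \<omega> u * (real r / u)" by simp
    also have "\<dots> \<le> \<omega> u * ((c + real r) / u)"
      using c u \<omega>u by (intro mult_left_mono divide_right_mono) auto
    finally show ?thesis .
  qed
  have "(\<integral>\<^sup>+t\<in>{0<..pi}. ennreal (\<omega> t * \<bar>q t\<bar>) \<partial>lborel)
    \<le> (\<integral>\<^sup>+t\<in>{0<..u}. ennreal (\<omega> u * ((c + real r) / u)) \<partial>lborel)
      + (\<integral>\<^sup>+t\<in>{u..pi}. ennreal (\<omega> t / t * \<bar>mean_kernel b t\<bar>) \<partial>lborel)"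
  proof (rule nn_integral_set_le_split)
    show "(\<lambda>t. indicator {u..pi} t * (\<omega> t / t * \<bar>mean_kernel b t\<bar>)) \<in> borel_measurable borel"
      using indicator_modulus_measurable[OF \<omega>, of "{u..pi}" "\<lambda>t. 1 / t * \<bar>mean_kernel b t\<bar>"] u pi_gt_zero
      by (simp add: subset_eq)
    show "\<omega> t * \<bar>q t\<bar> \<le> \<omega> t / t * \<bar>mean_kernel b t\<bar>" if "u \<le> t" "t \<le> pi" for t
      using that u ur by (intro kernel) auto
  qed (use u near in auto)
  also have "(\<integral>\<^sup>+t\<in>{0<..u}. ennreal (\<omega> u * ((c + real r) / u)) \<partial>lborel) = ennreal ((c + real r) * \<omega> u)"
    using u \<omega>u c by (simp add: nn_integral_cmult_indicator ennreal_mult[symmetric])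
  also have "ennreal ((c + real r) * \<omega> u) \<le> ennreal ((c + real r) * R)"
    using R c by (intro ennreal_leI mult_left_mono) auto
  also note far
  also have "ennreal ((c + real r) * R) + ennreal (C * R) = ennreal ((c + real r + C) * R)"
    using c C R0 by (simp add: distrib_right flip: ennreal_plus)
  finally show ?thesis unfolding q_def by (simp add: add_mono)
qed

theorem theorem3:
  fixes X :: fspace and a :: "nat \<Rightarrow> nat \<Rightarrow> real" and \<omega> H f :: "real \<Rightarrow> real" and r :: nat
  assumes X: "\<forall>p. X = Lp p \<longrightarrow> 1 \<le> p"
    and a: "summation_matrix a"
    and \<omega>: "modulus_type \<omega>"
    and H_nonneg: "\<forall>u\<in>{0<..pi}. 0 \<le> H u"
    and H_omega: "(\<lambda>u. LINT t:{u..pi}|lebesgue. \<omega> t / t\<^sup>2) \<in> O[principal {0<..pi}](H)"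
    and H_integrable: "set_integrable lebesgue {0<..pi} H"
    and H_int: "(\<lambda>u. LINT t:{0<..u}|lebesgue. H t) \<in> O[principal {0<..pi}](\<lambda>u. u * H u)"
    and f: "f \<in> space_omega X \<omega>"
    and r: "0 < r"
  shows
    "(set_integrable lebesgue {0<..2 * pi} (\<lambda>t. \<omega> t / t) \<and>
      (\<lambda>u. LINT t:{0<..u}|lebesgue. \<omega> t / t) \<in> O[principal {0..2 * pi}](\<omega>)
      \<longrightarrow>
      (\<forall>n. pointwise_in X (\<lambda>x. summable (\<lambda>k. a n k * conj_partial_sum f k x))) \<and>
      pointwise_in X (\<lambda>x. \<exists>l. ((\<lambda>\<epsilon>. conj_trunc f x \<epsilon>) \<longlongrightarrow> l) (at_right 0)) \<and>
      (\<forall>n. (\<lambda>x. conj_mean a n f x - conj_fun f x) \<in> space_of X) \<and>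
      (\<lambda>n. norm_of X (\<lambda>x. conj_mean a n f x - conj_fun f x))
        \<in> O[principal UNIV](\<lambda>n. \<omega> (pi / (real n + 1))
             + H (pi / (real n + 1)) * matrix_variation a n r))
     \<and>
     ((\<forall>n. summable (\<lambda>k. (real k + 1) * a n k)) \<and>
      (\<lambda>n. \<Sum>k. (real k + 1) * a n k) \<in> O[principal UNIV](\<lambda>n. real n + 1)
      \<longrightarrow>
      (\<forall>n. pointwise_in X (\<lambda>x. summable (\<lambda>k. a n k * conj_partial_sum f k x))) \<and>
      (\<forall>n. (\<lambda>x. conj_mean a n f x - conj_trunc f x (pi / (real r * (real n + 1)))) \<in> space_of X) \<and>
      (\<lambda>n. norm_of X (\<lambda>x. conj_mean a n f x - conj_trunc f x (pi / (real r * (real n + 1)))))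
        \<in> O[principal UNIV](\<lambda>n. \<omega> (pi / (real n + 1))
             + H (pi / (real n + 1)) * matrix_variation a n r))"
proof -
  have fX: "f \<in> space_of X" using f by (simp add: space_omega_def)
  interpret periodic_integrable f using X fX by (rule space_of_imp_periodic_integrable)
  have a_row: "0 \<le> a n k" "a n sums 1" for n k using a by (auto simp: summation_matrix_def)
  obtain K where K: "0 \<le> K" "\<And>t. 0 < t \<Longrightarrow> t \<le> pi \<Longrightarrow> norm_of X (\<lambda>x. psi f x t) \<le> K * \<omega> t"
    using norm_psi_le_modulus[OF X \<omega> f] by blast
  obtain C where C: "0 \<le> C" "\<And>b u. (\<And>k. 0 \<le> b k) \<Longrightarrow> b sums 1 \<Longrightarrow> 0 < u \<Longrightarrow> u \<le> pi \<Longrightarrow>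
      (\<integral>\<^sup>+t\<in>{u..pi}. ennreal (\<omega> t / t * \<bar>mean_kernel b t\<bar>) \<partial>lborel)
        \<le> ennreal (C * (\<omega> u + H u * row_variation b r))"
    using tail_bound[OF \<omega> r H_nonneg H_omega] by blast
  define u where "u n = pi / (real n + 1)" for n :: nat
  define R where "R n = \<omega> (u n) + H (u n) * matrix_variation a n r" for n
  have u: "0 < u n" "u n \<le> pi" for n by (auto simp: u_def field_simps)
  have \<omega>u: "0 \<le> \<omega> (u n)" for n using u[of n] by (intro modulus_nonneg[OF \<omega>]) auto
  have V: "matrix_variation a n r = row_variation (a n) r" for n
    by (simp add: matrix_variation_def row_variation_def)
  have R: "\<omega> (u n) \<le> R n" for n
    using row_variation_nonneg[OF a_row, of n r] H_nonneg u[of n] by (auto simp: R_def V)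
  have R0: "0 \<le> R n" for n using R[of n] \<omega>u[of n] by simp
  have tail: "(\<integral>\<^sup>+t\<in>{u n..pi}. ennreal (\<omega> t / t * \<bar>mean_kernel (a n) t\<bar>) \<partial>lborel) \<le> ennreal (C * R n)" for n
    unfolding R_def V using a_row u by (rule C(2))
  have transform:
    "pointwise_in X (\<lambda>x. set_integrable lebesgue {0<..pi} (\<lambda>t. psi f x t * \<kappa> t))"
    "\<lbrakk>periodic_2pi F; pointwise_in X (\<lambda>x. F x = (LINT t:{0<..pi}|lebesgue. psi f x t * \<kappa> t))\<rbrakk>
      \<Longrightarrow> F \<in> space_of X \<and> norm_of X F \<le> K * m"
    if \<kappa>: "\<kappa> \<in> borel_measurable borel" and m: "0 \<le> m"
      and weight: "(\<integral>\<^sup>+t\<in>{0<..pi}. ennreal (\<omega> t * \<bar>\<kappa> t\<bar>) \<partial>lborel) \<le> ennreal m" for \<kappa> m F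
  proof -
    note [measurable] = borel_measurable_clipped[OF \<omega>] \<kappa>
    \<comment> \<open>Only Borel measurability is at stake here; rules about Lebesgue sets would mislead the search.\<close>
    note [measurable del] = interval_in_sets_lebesgue borel_measurable_lebesgue_ident
    have "(\<integral>\<^sup>+t\<in>{0<..pi}. ennreal (K * clipped \<omega> t * \<bar>\<kappa> t\<bar>) \<partial>lborel)
        = (\<integral>\<^sup>+t. ennreal K * (ennreal (clipped \<omega> t * \<bar>\<kappa> t\<bar>) * indicator {0<..pi} t) \<partial>lborel)"
      using K(1) clipped_nonneg[OF \<omega>] by (intro nn_integral_cong) (auto simp: ennreal_mult mult.assoc split: split_indicator)
    also have "\<dots> = ennreal K * (\<integral>\<^sup>+t\<in>{0<..pi}. ennreal (clipped \<omega> t * \<bar>\<kappa> t\<bar>) \<partial>lborel)"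
      by (rule nn_integral_cmult) measurable
    also have "(\<integral>\<^sup>+t\<in>{0<..pi}. ennreal (clipped \<omega> t * \<bar>\<kappa> t\<bar>) \<partial>lborel)
        = (\<integral>\<^sup>+t\<in>{0<..pi}. ennreal (\<omega> t * \<bar>\<kappa> t\<bar>) \<partial>lborel)"
      by (intro nn_integral_cong) (auto simp: clipped_eq split: split_indicator)
    also have "ennreal K * \<dots> \<le> ennreal K * ennreal m" by (intro mult_left_mono weight) simp
    also have "\<dots> = ennreal (K * m)" using K m by (simp add: ennreal_mult)
    finally have w: "(\<integral>\<^sup>+t\<in>{0<..pi}. ennreal (K * clipped \<omega> t * \<bar>\<kappa> t\<bar>) \<partial>lborel) \<le> ennreal (K * m)" .
    have meas: "(\<lambda>t. K * clipped \<omega> t) \<in> borel_measurable borel" by measurable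
    have nonneg: "0 \<le> K * clipped \<omega> t" for t using K(1) clipped_nonneg[OF \<omega>] by simp
    have le: "norm_of X (\<lambda>x. psi f x t) \<le> K * clipped \<omega> t" if "0 < t" "t \<le> pi" for t
      using K(2)[OF that] that by (simp add: clipped_eq)
    have Km: "0 \<le> K * m" using K m by simp
    note T = psi_transform[OF X fX meas nonneg le \<kappa> Km w]
    show "pointwise_in X (\<lambda>x. set_integrable lebesgue {0<..pi} (\<lambda>t. psi f x t * \<kappa> t))" by (rule T(1))
    show "\<lbrakk>periodic_2pi F; pointwise_in X (\<lambda>x. F x = (LINT t:{0<..pi}|lebesgue. psi f x t * \<kappa> t))\<rbrakk>
      \<Longrightarrow> F \<in> space_of X \<and> norm_of X F \<le> K * m" by (rule T(2))
  qed
  have bigo: "(\<lambda>n. norm_of X (F n)) \<in> O[principal UNIV](R)"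
    if "\<And>n. F n \<in> space_of X \<and> norm_of X (F n) \<le> K * (D * R n)" for F :: "nat \<Rightarrow> real \<Rightarrow> real" and D
  proof (rule bigoI[of _ "K * D"])
    show "\<forall>\<^sub>F n in principal UNIV. norm (norm_of X (F n)) \<le> K * D * norm (R n)"
      using that norm_of_nonneg[of "F _" X] R0 by (simp add: eventually_principal mult.assoc)
  qed
  have conj_fun_case: "(\<forall>n. pointwise_in X (\<lambda>x. summable (\<lambda>k. a n k * conj_partial_sum f k x))) \<and>
      pointwise_in X (\<lambda>x. \<exists>l. ((\<lambda>\<epsilon>. conj_trunc f x \<epsilon>) \<longlongrightarrow> l) (at_right 0)) \<and>
      (\<forall>n. (\<lambda>x. conj_mean a n f x - conj_fun f x) \<in> space_of X) \<and>
      (\<lambda>n. norm_of X (\<lambda>x. conj_mean a n f x - conj_fun f x)) \<in> O[principal UNIV](R)"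
    if int: "set_integrable lebesgue {0<..2 * pi} (\<lambda>t. \<omega> t / t)"
      and O: "(\<lambda>u. LINT t:{0<..u}|lebesgue. \<omega> t / t) \<in> O[principal {0..2 * pi}](\<omega>)"
  proof -
    obtain c where c: "0 < c"
      "\<And>v. v \<in> {0..2 * pi} \<Longrightarrow> \<bar>LINT t:{0<..v}|lebesgue. \<omega> t / t\<bar> \<le> c * \<bar>\<omega> v\<bar>"
      using bigo_principalE[OF O] by blast
    have int_sub: "set_integrable lebesgue {0<..v} (\<lambda>t. \<omega> t / t)" if "v \<le> 2 * pi" for v
      using int by (rule set_integrable_subset) (use that in auto)
    have near: "(LINT t:{0<..u n}|lebesgue. \<omega> t / t) \<le> c * \<omega> (u n)" for n
    proof -
      have "\<bar>LINT t:{0<..u n}|lebesgue. \<omega> t / t\<bar> \<le> c * \<bar>\<omega> (u n)\<bar>"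
        using u[of n] by (intro c(2)) auto
      then show ?thesis using \<omega>u[of n] by simp
    qed
    \<comment> \<open>The transform with kernel \<open>\<pi>/t\<close> serves only to show that \<open>\<psi>\<^sub>x(t)/t\<close> is integrable for almost every \<open>x\<close>.\<close>
    have pole: "pointwise_in X (\<lambda>x. set_integrable lebesgue {0<..pi} (\<lambda>t. psi f x t * (pi / t)))"
    proof (rule transform(1))
      have eq: "(\<integral>\<^sup>+t\<in>{0<..pi}. ennreal (\<omega> t * \<bar>pi / t\<bar>) \<partial>lborel)
          = (\<integral>\<^sup>+t\<in>{0<..pi}. ennreal (pi * (\<omega> t / t)) \<partial>lborel)"
        by (intro nn_integral_cong) (auto split: split_indicator simp: mult.commute)
      also have "\<dots> = ennreal (LINT t:{0<..pi}|lebesgue. pi * (\<omega> t / t))"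
      proof (rule nn_integral_eq_set_integral)
        show "set_integrable lebesgue {0<..pi} (\<lambda>t. pi * (\<omega> t / t))"
          using int_sub[of pi] by (intro set_integrable_mult_right) auto
        show "0 \<le> pi * (\<omega> t / t)" if "t \<in> {0<..pi}" for t
          using that modulus_nonneg[OF \<omega>, of t] by auto
      qed
      finally show "(\<integral>\<^sup>+t\<in>{0<..pi}. ennreal (\<omega> t * \<bar>pi / t\<bar>) \<partial>lborel)
          \<le> ennreal \<bar>LINT t:{0<..pi}|lebesgue. pi * (\<omega> t / t)\<bar>"
        by (simp only: ennreal_leI abs_ge_self)
      show "(\<lambda>t. pi / t) \<in> borel_measurable borel" by measurable
    qed simp
    define \<kappa> where "\<kappa> n t = 1 / pi * (mean_kernel (a n) t / (2 * sin (t / 2)))" for n t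
    have \<kappa>: "\<kappa> n \<in> borel_measurable borel" for n unfolding \<kappa>_def by measurable
    have weight: "(\<integral>\<^sup>+t\<in>{0<..pi}. ennreal (\<omega> t * \<bar>\<kappa> n t\<bar>) \<partial>lborel) \<le> ennreal ((c + C) * R n)" for n
      unfolding \<kappa>_def using u[of n] c
      by (intro conj_fun_weight_bound[OF \<omega> a_row u int_sub near _ R C(1) tail]) auto
    define F where "F n x = conj_mean a n f x - conj_fun f x" for n x
    have F: "F n \<in> space_of X \<and> norm_of X (F n) \<le> K * ((c + C) * R n)" for n
    proof (rule transform(2)[OF \<kappa> _ weight])
      show "0 \<le> (c + C) * R n" using c C R0 by simp
      show "periodic_2pi (F n)"
        by (simp add: F_def periodic_2pi_def conj_mean_periodic conj_fun_periodic)
      show "pointwise_in X (\<lambda>x. F n x = (LINT t:{0<..pi}|lebesgue. psi f x t * \<kappa> n t))"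
        using pole unfolding F_def \<kappa>_def by (rule pointwise_in_mono) (rule conj_fun_deviation(3)[OF a_row])
    qed
    have "pointwise_in X (\<lambda>x. summable (\<lambda>k. a n k * conj_partial_sum f k x))" for n
      using pole by (rule pointwise_in_mono) (rule conj_fun_deviation(1)[OF a_row])
    moreover have "pointwise_in X (\<lambda>x. \<exists>l. (conj_trunc f x \<longlongrightarrow> l) (at_right 0))"
      using pole by (rule pointwise_in_mono) (rule conj_fun_deviation(2)[OF a_row])
    ultimately show ?thesis using F bigo[OF F] unfolding F_def by blast
  qed
  have conj_trunc_case: "(\<forall>n. pointwise_in X (\<lambda>x. summable (\<lambda>k. a n k * conj_partial_sum f k x))) \<and>
      (\<forall>n. (\<lambda>x. conj_mean a n f x - conj_trunc f x (pi / (real r * (real n + 1)))) \<in> space_of X) \<and>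
      (\<lambda>n. norm_of X (\<lambda>x. conj_mean a n f x - conj_trunc f x (pi / (real r * (real n + 1)))))
        \<in> O[principal UNIV](R)"
    if first: "\<And>n. summable (\<lambda>k. (real k + 1) * a n k)"
      and O: "(\<lambda>n. \<Sum>k. (real k + 1) * a n k) \<in> O[principal UNIV](\<lambda>n. real n + 1)"
  proof -
    obtain c where c: "0 < c" "\<And>n. \<bar>\<Sum>k. (real k + 1) * a n k\<bar> \<le> c * \<bar>real n + 1\<bar>"
      using bigo_principalE[OF O] by (metis UNIV_I)
    have first_le: "(\<Sum>k. (real k + 1) * a n k) \<le> (c * pi) / u n" for n
      using c(2)[of n] by (simp add: u_def)
    have \<epsilon>_eq: "pi / (real r * (real n + 1)) = u n / real r" for n by (simp add: u_def mult.commute)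
    have \<epsilon>: "0 < u n / real r" "u n / real r \<le> pi" for n
    proof -
      show "0 < u n / real r" using u[of n] r by simp
      have "u n / real r \<le> u n" using u[of n] r by (simp add: divide_le_eq)
      then show "u n / real r \<le> pi" using u[of n] by simp
    qed
    define \<kappa> where "\<kappa> n t = 1 / pi * (indicator {u n / real r..pi} t * (1 / 2 * cot (t / 2))
        - (1 / 2 * cot (t / 2) - mean_kernel (a n) t / (2 * sin (t / 2))))" for n t
    have \<kappa>: "\<kappa> n \<in> borel_measurable borel" for n unfolding \<kappa>_def cot_def by measurable
    have weight: "(\<integral>\<^sup>+t\<in>{0<..pi}. ennreal (\<omega> t * \<bar>\<kappa> n t\<bar>) \<partial>lborel)
        \<le> ennreal ((c * pi + real r + C) * R n)" for n
      unfolding \<kappa>_def using c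
      by (intro conj_trunc_weight_bound[OF \<omega> a_row u r first first_le _ R C(1) tail]) auto
    define F where "F n x = conj_mean a n f x - conj_trunc f x (u n / real r)" for n x
    have F: "F n \<in> space_of X \<and> norm_of X (F n) \<le> K * ((c * pi + real r + C) * R n)" for n
    proof (rule transform(2)[OF \<kappa> _ weight])
      show "0 \<le> (c * pi + real r + C) * R n" using c C R0 by simp
      show "periodic_2pi (F n)"
        by (simp add: F_def periodic_2pi_def conj_mean_periodic conj_trunc_periodic)
      show "pointwise_in X (\<lambda>x. F n x = (LINT t:{0<..pi}|lebesgue. psi f x t * \<kappa> n t))"
        unfolding F_def \<kappa>_def conj_trunc_deviation(2)[OF a_row first \<epsilon>] by (simp add: pointwise_in_def)
    qed
    have "pointwise_in X (\<lambda>x. summable (\<lambda>k. a n k * conj_partial_sum f k x))" for n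
      using conj_trunc_deviation(1)[of a n, OF a_row first \<epsilon>] by (simp add: pointwise_in_def)
    then show ?thesis using F bigo[OF F] unfolding \<epsilon>_eq F_def by blast
  qed
  note parts = conj_fun_case[unfolded R_def u_def] conj_trunc_case[unfolded R_def u_def]
  show ?thesis
    by (rule conjI; rule impI; elim conjE)
       (rule parts(1), assumption+, rule parts(2), (erule spec | assumption)+)
qed

end
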